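(* Let $k$ be a non-negative integer, let $\mathcal{C}$ be a self-dual $\mathbb{Z}_4$-code of length $24k+\alpha$ and minimum Lee weight $8k+\beta$, and let $C$ be a binary self-dual code (of length $24k+\alpha$) containing the residue code $\mathcal{C}^{(1)}$. (i) Suppose that $(\alpha,\beta)\in\{(14,6),(18,8),(20,8)\}$. Then $C$ is an s-extremal self-dual code having minimum weight $4k+4$. (ii) Suppose that $(\alpha,\beta)=(16,8)$. If $C$ is singly even, then $C$ is an s-extremal self-dual code having minimum weight $4k+4$. If $C$ is doubly even, then $C$ is extremal. (iii) Suppose that $(\alpha,\beta)=(22,8)$. Then $C$ is an s-extremal self-dual code having minimum weight $4k+4$ or $4k+6$.
   Context: A $\mathbb{Z}_4$-code of length $n$ is a $\mathbb{Z}_4$-submodule $\mathcal{C}$ of $\mathbb{Z}_4^n$, where $\mathbb{Z}_4=\{0,1,2,3\}$ is the ring of integers modulo $4$. Its dual is $\mathcal{C}^\perp=\{x\in\mathbb{Z}_4^n \mid x\cdot y=0 \text{ for all } y\in\mathcal{C}\}$, with $x\cdot y$ the standard inner product; $\mathcal{C}$ is self-dual if $\mathcal{C}=\mathcal{C}^\perp$. For $x\in\mathbb{Z}_4^n$ let $n_i(x)$ be the number of components of $x$ equal to $i$. The Lee weight of $x$ is $n_1(x)+2n_2(x)+n_3(x)$, and the minimum Lee weight of $\mathcal{C}$ is the smallest Lee weight among all non-zero codewords of $\mathcal{C}$. The residue code of $\mathcal{C}$ is the binary code $\mathcal{C}^{(1)}=\{c \bmod 2 \mid c\in\mathcal{C}\}$.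 A binary code is a linear subspace of $\mathbb{Z}_2^n$; it is self-dual if it equals its dual under the standard inner product. A binary self-dual code is doubly even if all codewords have weight divisible by $4$, and singly even if some codeword has weight congruent to $2$ modulo $4$ (a doubly even self-dual code of length $n$ exists only if $n\equiv 0\pmod 8$). A binary self-dual code of length $n$ is extremal if its minimum weight equals $4\lfloor n/24\rfloor+6$ when $n\equiv 22\pmod{24}$, and $4\lfloor n/24\rfloor+4$ otherwise. For a binary singly even self-dual code $C$, let $C_0$ be the subcode of codewords of weight congruent to $0$ modulo $4$; the shadow of $C$ is $S=C_0^\perp\setminus C$. Let $d(C)$ be the minimum weight of $C$ and $d(S)$ the minimum weight of the vectors in $S$. It is known that a binary self-dual code $C$ of length $n$ with shadow $S$ satisfies $d(S)\le \frac{n}{2}+4-2d(C)$, except when $n\equiv 22\pmod{24}$ and $d(C)=4\lfloor n/24\rfloor+6$, where $d(S)=\frac{n}{2}+8-2d(C)$. The code $C$ is called s-extremal if it meets this bound, i.e. $d(S)=\frac{n}{2}+4-2d(C)$ (respectively $d(S)=\frac{n}{2}+8-2d(C)$ in the exceptional case). *)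

theory Defs
  imports "HOL-Analysis.Analysis" "HOL-Library.Z2"
begin

text \<open>
  The ring of integers modulo 4 is the numeral type \<open>4\<close>, the binary field is the type
  \<open>bit\<close>.  A code of length \<open>n\<close> is a set of vectors over a finite index type \<open>'n\<close> with
  \<open>CARD('n) = n\<close>.
\<close>

definition linear_code :: "('a::comm_ring_1 ^ 'n) set \<Rightarrow> bool" where
  "linear_code C \<longleftrightarrow> module.subspace (*s) C"

lemma linear_code_iff:
  fixes C :: "('a::comm_ring_1 ^ 'n) set"
  shows
  "linear_code C \<longleftrightarrow> 0 \<in> C \<and> (\<forall>x\<in>C. \<forall>y\<in>C. x + y \<in> C) \<and> (\<forall>c. \<forall>x\<in>C. c *s x \<in> C)"
proof -
  have "module ((*s) :: 'a::comm_ring_1 \<Rightarrow> 'a ^ 'n \<Rightarrow> 'a ^ 'n)"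
    by unfold_locales (auto simp: vec_eq_iff algebra_simps)
  then show ?thesis
    unfolding linear_code_def by (simp add: module.subspace_def)
qed

definition dot :: "'a::comm_ring_1 ^ 'n::finite \<Rightarrow> 'a ^ 'n \<Rightarrow> 'a" where
  "dot x y = (\<Sum>i\<in>UNIV. x $ i * y $ i)"

definition dual_code :: "('a::comm_ring_1 ^ 'n::finite) set \<Rightarrow> ('a ^ 'n) set" where
  "dual_code C = {x. \<forall>y\<in>C. dot x y = 0}"

definition self_dual_code :: "('a::comm_ring_1 ^ 'n::finite) set \<Rightarrow> bool" where
  "self_dual_code C \<longleftrightarrow> linear_code C \<and> C = dual_code C"

definition count_comp :: "'a \<Rightarrow> 'a ^ 'n::finite \<Rightarrow> nat" where
  "count_comp a x = card {i. x $ i = a}"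

definition lee_weight :: "4 ^ 'n::finite \<Rightarrow> nat" where
  "lee_weight x = count_comp 1 x + 2 * count_comp 2 x + count_comp 3 x"

text \<open>The minima below are unspecified for the empty set, i.e. for the zero code.\<close>

definition min_lee_weight :: "(4 ^ 'n::finite) set \<Rightarrow> nat" where
  "min_lee_weight C = Min (lee_weight ` (C - {0}))"

definition mod2 :: "4 \<Rightarrow> bit" where
  "mod2 a = (if a = 1 \<or> a = 3 then 1 else 0)"

lemma mod2_of_int: "mod2 (of_int z) = of_int z"
proof -
  have four: "(4::4) = 0" by simp
  define q r where "q = z div 4" and "r = z mod 4"
  have z: "z = 4 * q + r" by (simp add: q_def r_def)
  have "r = 0 \<or> r = 1 \<or> r = 2 \<or> r = 3"
    using pos_mod_bound[of 4 z] pos_mod_sign[of 4 z] unfolding r_def by presburger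
  then show ?thesis
    unfolding z by (auto simp: mod2_def four)
qed

definition residue_code :: "(4 ^ 'n::finite) set \<Rightarrow> (bit ^ 'n) set" where
  "residue_code C = (\<lambda>c. \<chi> i. mod2 (c $ i)) ` C"

definition wt :: "bit ^ 'n::finite \<Rightarrow> nat" where
  "wt x = card {i. x $ i \<noteq> 0}"

definition min_weight :: "(bit ^ 'n::finite) set \<Rightarrow> nat" where
  "min_weight C = Min (wt ` (C - {0}))"

definition doubly_even :: "(bit ^ 'n::finite) set \<Rightarrow> bool" where
  "doubly_even C \<longleftrightarrow> self_dual_code C \<and> (\<forall>c\<in>C. 4 dvd wt c)"

definition singly_even :: "(bit ^ 'n::finite) set \<Rightarrow> bool" where
  "singly_even C \<longleftrightarrow> self_dual_code C \<and> (\<exists>c\<in>C. wt c mod 4 = 2)"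

definition extremal :: "(bit ^ 'n::finite) set \<Rightarrow> bool" where
  "extremal C \<longleftrightarrow> self_dual_code C \<and>
     min_weight C =
       (if CARD('n) mod 24 = 22 then 4 * (CARD('n) div 24) + 6 else 4 * (CARD('n) div 24) + 4)"

definition shadow :: "(bit ^ 'n::finite) set \<Rightarrow> (bit ^ 'n) set" where
  "shadow C = dual_code {c \<in> C. wt c mod 4 = 0} - C"

definition shadow_min_weight :: "(bit ^ 'n::finite) set \<Rightarrow> nat" where
  "shadow_min_weight C = Min (wt ` shadow C)"

text \<open>The shadow, and hence s-extremality, is only considered for singly even codes.\<close>

definition s_extremal :: "(bit ^ 'n::finite) set \<Rightarrow> bool" where
  "s_extremal C \<longleftrightarrow> singly_even C \<and>
     real (shadow_min_weight C) =
       (if CARD('n) mod 24 = 22 \<and> min_weight C = 4 * (CARD('n) div 24) + 6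
        then real CARD('n) / 2 + 8 - 2 * real (min_weight C)
        else real CARD('n) / 2 + 4 - 2 * real (min_weight C))"

end

theory Submission
  imports Defs "HOL-Computational_Algebra.Polynomial_FPS"
begin

text \<open>
  The residue code is doubly even, so \<open>C\<close> and its shadow \<open>S\<close> both lie in its dual, the torsion
  code; doubling a torsion word gives a word of \<open>\<C>\<close>, whence lower bounds for \<open>d(C)\<close> and \<open>d(S)\<close>.
  It remains to see that they are attained.  Character sums express the weight enumerator of \<open>C\<close>
  by that of \<open>S\<close>, which is palindromic and supported on weights congruent to \<open>n / 2\<close> modulo 4.
  This gives \<open>\<Sum>c\<in>C. Y ^ (wt c div 2) = (\<Sum>j\<le>R. a\<^sub>j (1 + Y) ^ (n / 2 - 4 j) (Y (1 - Y)\<^sup>2) ^ j)\<close>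
  with \<open>R = (n / 2 - d(S)) / 4\<close>, without invoking Gleason's theorem.  As \<open>C\<close> has no words of small
  weight, Lagrange inversion computes the first \<open>a\<^sub>j\<close> and the first nonzero coefficients on the left,
  and their signs decide everything.
\<close>

subsection \<open>Binary codes and character sums\<close>

declare add_bit_eq_xor [simp del] mult_bit_eq_and [simp del]

lemma UNIV_bit: "(UNIV :: bit set) = {0, 1}"
  using bit_not_zero_iff by blast

instance bit :: finite
  by standard (simp add: UNIV_bit)

lemma of_nat_bit_eq_0_iff: "(of_nat n :: bit) = 0 \<longleftrightarrow> even n"
  by (induction n) auto

text \<open>The nontrivial additive character of the binary field, with values in an arbitrary
  commutative ring.\<close>

definition bsign :: "bit \<Rightarrow> 'a::comm_ring_1" where
  "bsign b = (if b = 0 then 1 else - 1)"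

lemma bsign_0 [simp]: "bsign 0 = 1" and bsign_1 [simp]: "bsign 1 = - 1"
  by (simp_all add: bsign_def)

lemma bsign_add: "bsign (a + b) = bsign a * bsign b"
  by (cases a; cases b) simp_all

lemma bsign_square [simp]: "bsign a * bsign a = 1"
  by (cases a) simp_all

lemma bsign_sum: "bsign (sum f A) = (\<Prod>i\<in>A. bsign (f i))"
  by (induction A rule: infinite_finite_induct) (simp_all add: bsign_add)

lemma bsign_of_nat: "bsign (of_nat n) = (- 1) ^ n"
  by (induction n) (simp_all add: bsign_add)

lemma wt_le: "wt (x :: bit ^ 'n::finite) \<le> CARD('n)"
  unfolding wt_def by (rule card_mono) auto

lemma wt_eq_0_iff: "wt (x :: bit ^ 'n::finite) = 0 \<longleftrightarrow> x = 0"
  by (auto simp: wt_def vec_eq_iff)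

lemma wt_0 [simp]: "wt 0 = 0"
  by (simp add: wt_eq_0_iff)

lemma dot_add_left: "dot (x + y) z = dot x z + dot y z"
  by (simp add: dot_def algebra_simps sum.distrib)

lemma dot_add_right: "dot x (y + z) = dot x y + dot x z"
  by (simp add: dot_def algebra_simps sum.distrib)

lemma wt_power_prod:
  fixes a b :: "'a::comm_monoid_mult" and v :: "bit ^ 'n::finite"
  shows "(\<Prod>i\<in>UNIV. if v $ i = 0 then a else b) = a ^ (CARD('n) - wt v) * b ^ wt v"
proof -
  have *: "{i. v $ i = 0} = UNIV - {i. v $ i \<noteq> 0}" by auto
  have "card {i. v $ i = 0} = CARD('n) - wt v"
    unfolding * wt_def by (subst card_Diff_subset) auto
  then show ?thesis
    by (simp add: prod.If_cases wt_def Compl_eq)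
qed

lemma bit_vec_add_self [simp]: "x + x = (0 :: bit ^ 'n)"
  by (simp add: vec_eq_iff flip: mult_2)

lemma bit_add_self [simp]: "x + x = (0 :: bit)"
  by (simp flip: mult_2)

text \<open>The summand is a product over the coordinates, so the sum over all vectors factors into
  one two-term sum per coordinate. This is the Fourier transform behind the MacWilliams
  identity.\<close>

lemma weight_character_sum:
  fixes x z :: "'a::comm_ring_1" and c :: "bit ^ 'n::finite"
  shows "(\<Sum>v\<in>UNIV. x ^ (CARD('n) - wt v) * z ^ wt v * bsign (dot v c)) =
    (x + z) ^ (CARD('n) - wt c) * (x - z) ^ wt c"
proof -
  define f :: "'n \<Rightarrow> bit \<Rightarrow> 'a" where
    "f i b = (if b = 0 then x else z) * bsign (b * c $ i)" for i b
  \<comment> \<open>Vectors are identified with functions so that the sum of products can be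
    exchanged by \<open>prod_sum_PiE\<close>.\<close>
  have bij: "bij_betw vec_lambda (PiE UNIV (\<lambda>_::'n. UNIV :: bit set)) UNIV"
    by (rule bij_betwI[where g = vec_nth]) auto
  have "(\<Sum>v\<in>UNIV. x ^ (CARD('n) - wt v) * z ^ wt v * bsign (dot v c)) =
      (\<Sum>v\<in>UNIV. \<Prod>i\<in>UNIV. f i (v $ i))"
    by (simp add: f_def prod.distrib wt_power_prod dot_def bsign_sum)
  also have "\<dots> = (\<Sum>g\<in>PiE UNIV (\<lambda>_. UNIV). \<Prod>i\<in>UNIV. f i (vec_lambda g $ i))"
    by (rule sum.reindex_bij_betw[OF bij, symmetric])
  also have "\<dots> = (\<Prod>i\<in>UNIV. \<Sum>b\<in>UNIV. f i b)"
    by (subst prod_sum_PiE) auto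
  also have "\<dots> = (\<Prod>i\<in>UNIV. if c $ i = 0 then x + z else x - z)"
    by (intro prod.cong refl) (auto simp: f_def UNIV_bit)
  also have "\<dots> = (x + z) ^ (CARD('n) - wt c) * (x - z) ^ wt c"
    by (rule wt_power_prod)
  finally show ?thesis .
qed

lemma linear_code_add: "linear_code C \<Longrightarrow> x \<in> C \<Longrightarrow> y \<in> C \<Longrightarrow> x + y \<in> C"
  and linear_code_0: "linear_code C \<Longrightarrow> 0 \<in> C"
  by (simp_all add: linear_code_iff)

text \<open>Translation by a codeword where \<open>\<psi>\<close> takes the value 1 permutes
  \<open>C\<close> and negates every term; the sum is then its own negative and vanishes in
  characteristic 0.\<close>

lemma linear_code_character_sum:
  fixes C :: "(bit ^ 'n::finite) set" and \<psi> :: "bit ^ 'n \<Rightarrow> bit"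
  assumes C: "linear_code C"
    and hom: "\<And>x y. x \<in> C \<Longrightarrow> y \<in> C \<Longrightarrow> \<psi> (x + y) = \<psi> x + \<psi> y"
  shows "(\<Sum>c\<in>C. bsign (\<psi> c)) =
    (if \<forall>c\<in>C. \<psi> c = 0 then of_nat (card C) else (0 :: 'a::{idom, ring_char_0}))"
proof (cases "\<forall>c\<in>C. \<psi> c = 0")
  case False
  then obtain d where d: "d \<in> C" "\<psi> d = 1" by auto
  have "bij_betw (\<lambda>c. c + d) C C"
    by (rule bij_betwI[where g = "\<lambda>c. c + d"])
      (auto simp: C d linear_code_add add.assoc)
  then have "(\<Sum>c\<in>C. bsign (\<psi> c)) = (\<Sum>c\<in>C. bsign (\<psi> (c + d)) :: 'a)"
    by (rule sum.reindex_bij_betw[symmetric])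
  also have "\<dots> = (\<Sum>c\<in>C. - bsign (\<psi> c))"
    by (intro sum.cong refl) (simp only: hom d bsign_add, simp)
  finally have "(\<Sum>c\<in>C. bsign (\<psi> c)) = (0 :: 'a)"
    by (simp add: sum_negf)
  then show ?thesis using False by auto
qed simp

text \<open>Kept as a natural number because \<open>dot\<close> only sees its parity, while weights
  are needed modulo 4.\<close>

definition overlap :: "bit ^ 'n::finite \<Rightarrow> bit ^ 'n \<Rightarrow> nat" where
  "overlap x y = card {i. x $ i = 1 \<and> y $ i = 1}"

lemma wt_add: "wt (x + y) + 2 * overlap x y = wt x + wt y"
proof -
  let ?A = "{i. x $ i = 1}" and ?B = "{i. y $ i = 1}"
  have "wt (x + y) = card ((?A - ?B) \<union> (?B - ?A))"
    unfolding wt_def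
  proof (rule arg_cong[where f = card], rule set_eqI)
    fix i
    show "i \<in> {i. (x + y) $ i \<noteq> 0} \<longleftrightarrow> i \<in> (?A - ?B) \<union> (?B - ?A)"
      by (cases "x $ i"; cases "y $ i") simp_all
  qed
  also have "\<dots> = card (?A - ?B) + card (?B - ?A)"
    by (rule card_Un_disjoint) auto
  finally have 1: "wt (x + y) = card (?A - ?B) + card (?B - ?A)" .
  have 2: "wt x = card (?A - ?B) + overlap x y"
    unfolding wt_def overlap_def
    by (subst card_Un_disjoint[symmetric]) (auto intro!: arg_cong[where f = card])
  have 3: "wt y = card (?B - ?A) + overlap x y"
    unfolding wt_def overlap_def
    by (subst card_Un_disjoint[symmetric]) (auto intro!: arg_cong[where f = card])
  show ?thesis using 1 2 3 by simp
qed

lemma dot_eq_overlap: "dot x y = of_nat (overlap x y)"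
proof -
  have "dot x y = (\<Sum>i\<in>UNIV. if x $ i = 1 \<and> y $ i = 1 then 1 else 0)"
    unfolding dot_def by (intro sum.cong refl) auto
  also have "\<dots> = of_nat (overlap x y)"
    by (simp add: overlap_def sum.If_cases)
  finally show ?thesis .
qed

lemma dot_self: "dot x x = of_nat (wt x)"
  by (simp add: dot_eq_overlap overlap_def wt_def)

lemma dot_one: "dot 1 x = of_nat (wt x)"
  by (simp add: dot_eq_overlap overlap_def wt_def)

section \<open>Self-dual binary codes and the generalized shadow\<close>

lemma self_dual_codeD:
  fixes C :: "('a::comm_ring_1 ^ 'n::finite) set"
  assumes "self_dual_code C"
  shows "linear_code C" "x \<in> C \<longleftrightarrow> (\<forall>y\<in>C. dot x y = 0)"
  using assms by (auto simp: self_dual_code_def dual_code_def)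

lemma self_dual_even_wt: "self_dual_code C \<Longrightarrow> c \<in> C \<Longrightarrow> even (wt c)"
  using self_dual_codeD(2)[of C c] by (auto simp: dot_self of_nat_bit_eq_0_iff)

text \<open>Equals the shadow for a singly even code and the code itself for a doubly even one, so
  that both cases share the same character sums.\<close>

definition gen_shadow :: "(bit ^ 'n::finite) set \<Rightarrow> (bit ^ 'n) set" where
  "gen_shadow C = {v. \<forall>c\<in>C. dot v c = of_nat (wt c div 2)}"

text \<open>Orthogonal words have even overlap, so halving \<open>wt_add\<close> gives an identity
  modulo 2. Half the weight thus defines a homomorphism on \<open>C\<close>, as
  \<open>linear_code_character_sum\<close> requires.\<close>

lemma half_wt_add:
  assumes "self_dual_code C" "x \<in> C" "y \<in> C"
  shows "(of_nat (wt (x + y) div 2) :: bit) = of_nat (wt x div 2) + of_nat (wt y div 2)"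
proof -
  have "dot x y = 0" using assms self_dual_codeD(2) by blast
  then have "even (overlap x y)"
    by (simp add: dot_eq_overlap of_nat_bit_eq_0_iff)
  moreover have "wt (x + y) + 2 * overlap x y = wt x + wt y" by (rule wt_add)
  moreover have "even (wt x)" "even (wt y)" using assms self_dual_even_wt by blast+
  ultimately have "even (wt (x + y) div 2 + (wt x div 2 + wt y div 2))"
    by presburger
  then have "(of_nat (wt (x + y) div 2 + (wt x div 2 + wt y div 2)) :: bit) = 0"
    by (simp only: of_nat_bit_eq_0_iff)
  then show ?thesis
    by (metis bit_add_self add.assoc add.commute add.right_neutral of_nat_add)
qed

lemma gen_shadow_indicator:
  assumes C: "self_dual_code C"
  shows "(\<Sum>c\<in>C. bsign (dot v c + of_nat (wt c div 2))) =
    (if v \<in> gen_shadow C then of_nat (card C) else (0 :: 'a::{idom, ring_char_0}))"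
proof -
  have "(\<Sum>c\<in>C. bsign (dot v c + of_nat (wt c div 2))) =
     (if \<forall>c\<in>C. dot v c + of_nat (wt c div 2) = 0 then of_nat (card C) else (0 :: 'a))"
    by (rule linear_code_character_sum)
      (use C in \<open>simp_all add: self_dual_codeD dot_add_right half_wt_add ac_simps\<close>)
  moreover have "a + b = 0 \<longleftrightarrow> a = b" for a b :: bit
    by (cases a; cases b) simp_all
  ultimately show ?thesis
    by (simp add: gen_shadow_def)
qed

lemma code_indicator:
  assumes C: "self_dual_code C"
  shows "(\<Sum>c\<in>C. bsign (dot v c)) =
    (if v \<in> C then of_nat (card C) else (0 :: 'a::{idom, ring_char_0}))"
  using self_dual_codeD(2)[OF C, of v]
  by (subst linear_code_character_sum) (use C in \<open>simp_all add: self_dual_codeD(1) dot_add_right\<close>)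

text \<open>Membership in the generalized shadow is written as a character sum over
  \<open>C\<close>; exchanging the sums leaves \<open>weight_character_sum\<close> inside. The signs
  distinguish this from the MacWilliams identity for \<open>C\<close>.\<close>

lemma gen_shadow_transform:
  fixes C :: "(bit ^ 'n::finite) set" and x z :: "'a::{idom, ring_char_0}"
  assumes C: "self_dual_code C"
  shows "of_nat (card C) * (\<Sum>v\<in>gen_shadow C. x ^ (CARD('n) - wt v) * z ^ wt v) =
    (\<Sum>c\<in>C. (- 1) ^ (wt c div 2) * ((x + z) ^ (CARD('n) - wt c) * (x - z) ^ wt c))"
proof -
  let ?f = "\<lambda>v :: bit ^ 'n. x ^ (CARD('n) - wt v) * z ^ wt v"
  have "of_nat (card C) * sum ?f (gen_shadow C) =
      (\<Sum>v\<in>UNIV. ?f v * (\<Sum>c\<in>C. bsign (dot v c + of_nat (wt c div 2))))"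
    by (simp add: gen_shadow_indicator[OF C] if_distrib sum.If_cases sum_distrib_left mult.commute
        cong: if_cong)
  also have "\<dots> = (\<Sum>v\<in>UNIV. \<Sum>c\<in>C. (- 1) ^ (wt c div 2) * (?f v * bsign (dot v c)))"
    by (simp add: sum_distrib_left bsign_add bsign_of_nat mult_ac)
  also have "\<dots> = (\<Sum>c\<in>C. (- 1) ^ (wt c div 2) * (\<Sum>v\<in>UNIV. ?f v * bsign (dot v c)))"
    by (subst sum.swap) (simp add: sum_distrib_left)
  finally show ?thesis
    by (simp add: weight_character_sum)
qed

text \<open>The overlap of \<open>v\<close> and \<open>c\<close> has the parity of
  \<open>wt c div 2\<close>, so in \<open>wt_add\<close> twice the overlap and \<open>wt c\<close>
  cancel modulo 4.\<close>

lemma gen_shadow_wt_coset: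
  assumes C: "self_dual_code C" and v: "v \<in> gen_shadow C" and c: "c \<in> C"
  shows "wt (v + c) mod 4 = wt v mod 4"
proof -
  have "(of_nat (overlap v c) :: bit) = of_nat (wt c div 2)"
    using v c by (auto simp: gen_shadow_def dot_eq_overlap)
  then have "(of_nat (overlap v c + wt c div 2) :: bit) = 0" by simp
  then have "even (overlap v c + wt c div 2)"
    by (simp only: of_nat_bit_eq_0_iff)
  then obtain m where m: "overlap v c + wt c div 2 = 2 * m" by (rule evenE)
  obtain h where h: "wt c = 2 * h" using self_dual_even_wt[OF C c] by (rule evenE)
  have "wt (v + c) + 4 * m = wt v + 4 * h"
    using wt_add[of v c] m h by simp
  then have "(wt (v + c) + 4 * m) mod 4 = (wt v + 4 * h) mod 4" by (rule arg_cong)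
  then show ?thesis by simp
qed

lemma i_power_mod_4: "\<i> ^ n = \<i> ^ (n mod 4)"
proof -
  have "\<i> ^ n = (\<i> ^ 4) ^ (n div 4) * \<i> ^ (n mod 4)"
    by (metis mult_div_mod_eq power_add power_mult)
  then show ?thesis by (simp add: power4_eq_xxxx)
qed

lemma i_power_eq_iff: "\<i> ^ m = \<i> ^ n \<longleftrightarrow> m mod 4 = n mod 4"
proof
  assume *: "\<i> ^ m = \<i> ^ n"
  have "m mod 4 < 4" "n mod 4 < 4" by simp_all
  then have "m mod 4 \<in> {0, 1, 2, 3}" "n mod 4 \<in> {0, 1, 2, 3}" by auto
  moreover have "\<i> ^ (m mod 4) = \<i> ^ (n mod 4)"
    using * i_power_mod_4 by metis
  ultimately show "m mod 4 = n mod 4"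
    by (auto simp: complex_eq_iff numeral_3_eq_3)
qed (metis i_power_mod_4)

text \<open>Poisson summation for the Gauss sum \<open>\<Sum>c\<in>C. \<i> ^ wt (v + c)\<close>, all of whose terms are equal.\<close>

lemma gen_shadow_wt_mod_4:
  fixes C :: "(bit ^ 'n::finite) set"
  assumes C: "self_dual_code C" and n: "CARD('n) = 2 * N" and v: "v \<in> gen_shadow C"
  shows "wt v mod 4 = N mod 4"
proof -
  have dot_shift: "dot (x + v) u = dot x u + dot v u" for x u by (rule dot_add_left)
  have bij: "bij_betw (\<lambda>x. x + v) UNIV UNIV"
    by (rule bij_betwI[where g = "\<lambda>x. x + v"]) (auto simp: add.assoc)
  \<comment> \<open>The translation by \<open>v\<close> produces the sign
    \<open>bsign (dot v u)\<close>, which cancels against \<open>(- \<i>) ^ wt u\<close>; the value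
    is therefore the same for every codeword \<open>u\<close>.\<close>
  have gauss: "(\<Sum>x\<in>UNIV. \<i> ^ wt (x + v) * bsign (dot x u)) = (2 * \<i>) ^ N" if u: "u \<in> C" for u
  proof -
    have "(\<Sum>x\<in>UNIV. \<i> ^ wt (x + v) * bsign (dot x u)) =
        bsign (dot v u) * (\<Sum>x\<in>UNIV. \<i> ^ wt (x + v) * bsign (dot (x + v) u))"
      by (simp add: sum_distrib_left dot_add_left bsign_add mult_ac)
        (simp flip: mult.assoc add: mult.commute)
    also have "(\<Sum>x\<in>UNIV. \<i> ^ wt (x + v) * bsign (dot (x + v) u)) =
        (\<Sum>y\<in>UNIV. \<i> ^ wt y * bsign (dot y u))"
      by (rule sum.reindex_bij_betw[OF bij, where g = "\<lambda>y. \<i> ^ wt y * bsign (dot y u)"])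
    also have "\<dots> = (1 + \<i>) ^ (CARD('n) - wt u) * (1 - \<i>) ^ wt u"
      using weight_character_sum[where x = "1 :: complex" and z = \<i> and c = u] by simp
    also have "1 - \<i> = - \<i> * (1 + \<i>)"
      by (simp add: algebra_simps)
    also have "(1 + \<i>) ^ (CARD('n) - wt u) * (- \<i> * (1 + \<i>)) ^ wt u =
        (1 + \<i>) ^ (2 * N) * (- \<i>) ^ wt u"
      using wt_le[of u] n by (simp only: power_mult_distrib mult.left_commute flip: power_add)
        simp
    also have "(1 + \<i>) ^ (2 * N) = (2 * \<i>) ^ N"
      unfolding power_mult by (rule arg_cong[where f = "\<lambda>z. z ^ N"])
        (simp add: power2_eq_square algebra_simps)
    also have "(- \<i>) ^ wt u = bsign (dot v u)"
    proof -
      obtain h where h: "wt u = 2 * h" using self_dual_even_wt[OF C u] by blast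
      have "dot v u = of_nat h" using v u h by (auto simp: gen_shadow_def)
      then show ?thesis by (simp add: h power_mult bsign_of_nat)
    qed
    finally show ?thesis
      by (simp add: mult_ac)
  qed
  have coset: "\<i> ^ wt (c + v) = \<i> ^ wt v" if "c \<in> C" for c
    using gen_shadow_wt_coset[OF C v that] by (simp only: i_power_eq_iff add.commute)
  have "of_nat (card C) * (of_nat (card C) * \<i> ^ wt v) =
      of_nat (card C) * (\<Sum>c\<in>C. \<i> ^ wt (c + v))"
    by (simp add: coset)
  also have "\<dots> = (\<Sum>x\<in>UNIV. \<i> ^ wt (x + v) * (\<Sum>u\<in>C. bsign (dot x u)))"
    by (simp add: code_indicator[OF C] if_distrib sum.If_cases sum_distrib_left mult.commute
        cong: if_cong)
  also have "\<dots> = (\<Sum>u\<in>C. \<Sum>x\<in>UNIV. \<i> ^ wt (x + v) * bsign (dot x u))"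
    by (subst sum.swap) (simp add: sum_distrib_left)
  also have "\<dots> = of_nat (card C) * (2 * \<i>) ^ N"
    by (simp add: gauss)
  finally have *: "of_nat (card C) * \<i> ^ wt v = (2 * \<i>) ^ N"
    using linear_code_0[OF self_dual_codeD(1)[OF C]] by auto
  \<comment> \<open>Absolute values determine the cardinality of \<open>C\<close>; after cancelling
    it only powers of \<open>\<i>\<close> remain.\<close>
  from arg_cong[where f = norm, OF this] have "real (card C) = 2 ^ N"
    by (simp add: norm_mult norm_power)
  then have "card C = 2 ^ N" by (metis of_nat_eq_iff of_nat_numeral of_nat_power)
  with * have "\<i> ^ wt v = \<i> ^ N"
    by (simp add: power_mult_distrib)
  then show ?thesis by (simp add: i_power_eq_iff)
qed

subsection \<open>Lagrange inversion\<close>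

lemma fps_deriv_inverse_power:
  fixes f :: "'a::field fps"
  assumes "fps_nth f 0 \<noteq> 0"
  shows "fps_deriv (inverse f ^ n) = - (of_nat n * fps_deriv f * inverse f ^ Suc n)"
  unfolding fps_deriv_power' fps_inverse_deriv[OF assms]
  by (cases n) (simp_all add: power2_eq_square mult_ac)

text \<open>
  Lagrange inversion: for \<open>i < j\<close> the coefficient in question is that of
  \<open>w - X w' / (j - i)\<close> at \<open>X ^ (j - i)\<close>, where \<open>w = \<psi> ^ (i - j)\<close>, and this vanishes.
\<close>

lemma fps_Lagrange_monomial:
  fixes \<psi> :: "'a::field_char_0 fps"
  assumes \<psi>: "fps_nth \<psi> 0 = 1" and j: "j > 0"
  shows "fps_nth (fps_deriv ((fps_X * \<psi>) ^ i) * inverse \<psi> ^ j) (j - 1) =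
    (if i = j then of_nat j else 0)"
proof (cases i)
  case 0
  with j show ?thesis by simp
next
  case (Suc l)
  let ?w = "inverse \<psi>"
  have w: "\<psi> * ?w = 1" using \<psi> by (simp add: inverse_mult_eq_1')
  have dpow: "fps_deriv ((fps_X * \<psi>) ^ i) = of_nat i * fps_deriv (fps_X * \<psi>) * (fps_X * \<psi>) ^ l"
    by (simp only: fps_deriv_power' Suc diff_Suc_1)
  have D: "fps_deriv ((fps_X * \<psi>) ^ i) * ?w ^ j =
      of_nat i * (fps_X ^ l * (\<psi> ^ l * ?w ^ j * (\<psi> + fps_X * fps_deriv \<psi>)))"
    unfolding dpow by (simp add: power_mult_distrib algebra_simps del: of_nat_Suc)
  consider "i < j" | "i = j" | "i > j" by linarith
  then show ?thesis
  proof cases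
    case 1
    define m where "m = j - i"
    have m: "m > 0" "j = m + i" using 1 by (simp_all add: m_def)
    have wi: "\<psi> ^ q * ?w ^ q = 1" for q
      using w by (simp flip: power_mult_distrib)
    have "\<psi> ^ l * ?w ^ j * (\<psi> + fps_X * fps_deriv \<psi>) =
        (\<psi> ^ l * ?w ^ l) * ((\<psi> * ?w) * ?w ^ m + fps_X * (fps_deriv \<psi> * ?w ^ Suc m))"
      by (simp add: m Suc power_add algebra_simps)
    also have "\<dots> = ?w ^ m + fps_X * (fps_deriv \<psi> * ?w ^ Suc m)"
      by (simp add: wi w)
    finally have *: "\<psi> ^ l * ?w ^ j * (\<psi> + fps_X * fps_deriv \<psi>) =
        ?w ^ m + fps_X * (fps_deriv \<psi> * ?w ^ Suc m)" .
    have "fps_deriv (?w ^ m) = - (of_nat m * (fps_deriv \<psi> * ?w ^ Suc m))"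
      using \<psi> by (simp add: fps_deriv_inverse_power mult.assoc del: power_Suc)
    then have "fps_X * (of_nat m * (fps_deriv \<psi> * ?w ^ Suc m)) = - (fps_X * fps_deriv (?w ^ m))"
      by (simp only: minus_mult_right minus_minus)
    then have "fps_nth (fps_X * (of_nat m * (fps_deriv \<psi> * ?w ^ Suc m))) m =
        - of_nat m * fps_nth (?w ^ m) m"
      unfolding fps_mult_fps_X_deriv_shift by simp
    then have "of_nat m * fps_nth (fps_X * (fps_deriv \<psi> * ?w ^ Suc m)) m =
        of_nat m * - fps_nth (?w ^ m) m"
      by (simp add: mult.left_commute[of fps_X] fps_mult_of_nat_nth(1) del: power_Suc)
    then have "fps_nth (fps_X * (fps_deriv \<psi> * ?w ^ Suc m)) m = - fps_nth (?w ^ m) m"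
      using m(1) by (simp only: mult_cancel_left of_nat_eq_0_iff) simp
    moreover have "j - 1 - l = m" "l \<le> j - 1" using m Suc by simp_all
    ultimately show ?thesis
      unfolding D * using 1 by (simp add: fps_mult_of_nat_nth(1) fps_X_power_mult_nth del: power_Suc)
  next
    case 2
    then have "j - 1 = l" using Suc by simp
    then show ?thesis
      unfolding D using \<psi> 2 by (simp add: fps_mult_of_nat_nth(1) fps_X_power_mult_nth fps_power_zeroth)
  next
    case 3
    then show ?thesis
      unfolding D using Suc j by (simp add: fps_mult_of_nat_nth(1) fps_X_power_mult_nth del: of_nat_Suc)
  qed
qed

text \<open>Differentiating, multiplying by \<open>inverse \<psi> ^ j\<close> and reading the
  coefficient at \<open>j - 1\<close> isolates \<open>a j\<close> by
  \<open>fps_Lagrange_monomial\<close>. For \<open>j > R\<close> the left side is 0, and the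
  identity then computes the coefficient of \<open>F\<close> at \<open>j\<close>.\<close>

lemma fps_Lagrange:
  fixes F E \<psi> :: "'a::field_char_0 fps"
  assumes \<psi>: "fps_nth \<psi> 0 = 1" and j: "j > 0" and E: "fps_nth E 0 = 1"
    and F0: "fps_nth F 0 = 1" and F: "\<And>i. 0 < i \<Longrightarrow> i < j \<Longrightarrow> fps_nth F i = 0"
    and eq: "F * E = (\<Sum>i\<le>R. fps_const (a i) * (fps_X * \<psi>) ^ i)"
  shows "of_nat j * (if j \<le> R then a j else 0) =
    of_nat j * fps_nth F j + fps_nth (fps_deriv E * inverse \<psi> ^ j) (j - 1)"
proof -
  define H where "H = fps_shift j F"
  have FH: "F = 1 + fps_X ^ j * H"
    unfolding H_def using F0 F j by (auto simp: fps_eq_iff fps_X_power_mult_nth)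
  have H0: "fps_nth H 0 = fps_nth F j" by (simp add: H_def)
  have jj: "fps_X ^ j = fps_X * (fps_X ^ (j - 1) :: 'a fps)"
    using j by (cases j) simp_all
  have dX: "fps_deriv (fps_X ^ j) = (of_nat j * fps_X ^ (j - 1) :: 'a fps)"
    by (simp add: fps_deriv_power')
  \<comment> \<open>Every term with \<open>H\<close> carries the factor
    \<open>fps_X ^ (j - 1)\<close>, so only the constant term of the bracket,
    \<open>of_nat j * fps_nth H 0\<close>, reaches the coefficient at \<open>j - 1\<close>.\<close>
  have "fps_deriv (F * E) * inverse \<psi> ^ j =
      fps_deriv E * inverse \<psi> ^ j +
      fps_X ^ (j - 1) * ((of_nat j * H + fps_X * fps_deriv H) * E * inverse \<psi> ^ j +
        fps_X * H * fps_deriv E * inverse \<psi> ^ j)"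
    unfolding FH by (simp only: fps_deriv_mult fps_deriv_add fps_deriv_1 dX)
      (simp add: jj algebra_simps)
  then have "fps_nth (fps_deriv (F * E) * inverse \<psi> ^ j) (j - 1) =
      fps_nth (fps_deriv E * inverse \<psi> ^ j) (j - 1) + of_nat j * fps_nth F j"
    using \<psi> E by (simp add: fps_X_power_mult_nth fps_mult_of_nat_nth(1) fps_power_zeroth H0)
  moreover have "fps_nth (fps_deriv (F * E) * inverse \<psi> ^ j) (j - 1) =
      (\<Sum>i\<le>R. a i * fps_nth (fps_deriv ((fps_X * \<psi>) ^ i) * inverse \<psi> ^ j) (j - 1))"
    unfolding eq by (simp add: fps_deriv_sum sum_distrib_right fps_sum_nth mult.assoc)
  moreover have "\<dots> = of_nat j * (if j \<le> R then a j else 0)"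
    by (simp add: fps_Lagrange_monomial[OF \<psi> j, unfolded One_nat_def] if_distrib cong: if_cong)
  ultimately show ?thesis by (metis add.commute)
qed

section \<open>Positivity of power series coefficients\<close>

definition even_pos :: "'a::linordered_field fps \<Rightarrow> bool" where
  "even_pos f \<longleftrightarrow> (\<forall>n. if even n then fps_nth f n > 0 else fps_nth f n = 0)"

lemma even_pos_nth:
  assumes "even_pos f"
  shows "even n \<Longrightarrow> fps_nth f n > 0" "odd n \<Longrightarrow> fps_nth f n = 0" "fps_nth f n \<ge> 0"
  using assms unfolding even_pos_def by (metis, metis, metis order.refl less_imp_le)

text \<open>In the convolution only the indices of the parity of \<open>n\<close> survive, so
  \<open>h\<close> may have negative coefficients at the other indices.\<close>

lemma even_pos_mult_nth_pos:
  assumes f: "even_pos f" and h: "\<And>i. i \<le> n \<Longrightarrow> even (n - i) \<Longrightarrow> fps_nth h i \<ge> 0"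
    and i: "i \<le> n" "even (n - i)" "fps_nth h i > 0"
  shows "fps_nth (h * f) n > 0"
proof -
  have "0 \<le> fps_nth h i * fps_nth f (n - i)" if "i \<le> n" for i
    using that h[of i] even_pos_nth[OF f, of "n - i"] by (cases "even (n - i)") auto
  moreover have "0 < fps_nth h i * fps_nth f (n - i)"
    using i even_pos_nth[OF f] by simp
  ultimately show ?thesis
    unfolding fps_mult_nth using i(1) by (intro sum_pos2[of _ i]) auto
qed

lemma even_pos_mult:
  assumes "even_pos f" "even_pos g"
  shows "even_pos (f * g)"
  unfolding even_pos_def
proof (intro allI)
  fix n
  show "if even n then fps_nth (f * g) n > 0 else fps_nth (f * g) n = 0"
  proof (cases "even n")
    case True
    then show ?thesis
      using even_pos_mult_nth_pos[OF assms(2), of n f 0] even_pos_nth[OF assms(1)] by simp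
  next
    case False
    then have "fps_nth f i * fps_nth g (n - i) = 0" if "i \<le> n" for i
      using that even_pos_nth[OF assms(1), of i] even_pos_nth[OF assms(2), of "n - i"]
      by (cases "even i") auto
    then show ?thesis using False by (auto simp: fps_mult_nth intro!: sum.neutral)
  qed
qed

text \<open>The product is the inverse of \<open>1 - fps_X ^ 2\<close>, a geometric series in even
  powers.\<close>

lemma even_pos_inverse_one_minus_square:
  "even_pos (inverse (1 + fps_X) * inverse (1 - fps_X) :: 'a::linordered_field fps)"
proof -
  let ?e = "Abs_fps (\<lambda>n. if even n then 1 else 0) :: 'a fps"
  have "(1 + fps_X) * (1 - fps_X) = (1 - fps_X ^ 2 :: 'a fps)"
    by (simp add: algebra_simps power2_eq_square)
  moreover have "(1 - fps_X ^ 2) * ?e = 1"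
    by (auto simp: fps_eq_iff algebra_simps fps_X_power_mult_nth)
  ultimately have "(1 + fps_X) * (1 - fps_X) * ?e = 1"
    by (simp only:)
  then have "inverse ((1 + fps_X) * (1 - fps_X)) = ?e"
    by (rule fps_inverse_unique)
  then show ?thesis
    by (simp add: fps_inverse_mult even_pos_def)
qed

lemma even_pos_power: "m > 0 \<Longrightarrow> even_pos f \<Longrightarrow> even_pos (f ^ m)"
proof (induction m rule: nat_induct_non_zero)
  case (Suc m)
  then show ?case by (simp add: even_pos_mult)
qed simp

lemma one_minus_fps_X_power_nth:
  "fps_nth ((1 - fps_X) ^ q :: 'a::comm_ring_1 fps) i = (- 1) ^ i * of_nat (q choose i)"
proof (induction q arbitrary: i)
  case 0
  then show ?case by (cases i) simp_all
next
  case (Suc q)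
  then show ?case by (cases i) (simp_all add: algebra_simps)
qed

lemma one_plus_fps_X_power_nth:
  "fps_nth ((1 + fps_X) ^ q :: 'a::comm_ring_1 fps) i = of_nat (q choose i)"
proof (induction q arbitrary: i)
  case 0
  then show ?case by (cases i) simp_all
next
  case (Suc q)
  then show ?case by (cases i) (simp_all add: algebra_simps)
qed

lemma inverse_one_minus_fps_X_power_nth_pos:
  "q > 0 \<Longrightarrow> fps_nth (inverse (1 - fps_X) ^ q :: 'a::linordered_field fps) n > 0"
proof (induction q arbitrary: n rule: nat_induct_non_zero)
  case 1
  then show ?case by (simp add: fps_inverse_one_minus_fps_X)
next
  case (Suc q)
  have "fps_nth (inverse (1 - fps_X) * inverse (1 - fps_X) ^ q :: 'a fps) n > 0"
    unfolding fps_mult_nth using Suc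
    by (intro sum_pos) (auto simp: fps_inverse_one_minus_fps_X)
  then show ?case by simp
qed

text \<open>Up to the factor \<open>- N\<close>, this is the derivative term of
  \<open>fps_Lagrange\<close> for \<open>E = inverse (1 + fps_X) ^ N\<close> and
  \<open>\<psi> = (1 - fps_X) ^ 2 * inverse (1 + fps_X) ^ 4\<close>.\<close>

definition lagrange_coeff :: "nat \<Rightarrow> nat \<Rightarrow> 'a::field_char_0" where
  "lagrange_coeff N j = fps_nth
     ((1 + fps_X) ^ (4 * j) * inverse (1 + fps_X) ^ Suc N * inverse (1 - fps_X) ^ (2 * j)) (j - 1)"

lemma fps_inverse_power_cancel:
  fixes f :: "'a::field fps"
  assumes "fps_nth f 0 \<noteq> 0"
  shows "f ^ q * inverse f ^ q = 1"
  using inverse_mult_eq_1'[OF assms] by (simp flip: power_mult_distrib)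

lemma fps_power_diff_inverse:
  fixes f :: "'a::field fps"
  assumes "fps_nth f 0 \<noteq> 0" "m \<le> n"
  shows "f ^ (n - m) * inverse f ^ n = inverse f ^ m"
proof -
  have "f ^ (n - m) * inverse f ^ n = (f ^ (n - m) * inverse f ^ (n - m)) * inverse f ^ m"
    using assms(2) by (simp add: mult.assoc flip: power_add)
  then show ?thesis by (simp add: fps_inverse_power_cancel[OF assms(1)])
qed

text \<open>Inserting \<open>(1 + fps_X) ^ (2 * j)\<close> and its inverse pairs up the denominators
  into a power of an even series; what is left over is a polynomial with nonnegative
  coefficients.\<close>

lemma lagrange_coeff_eq1:
  assumes "6 * j = Suc N + q"
  shows "lagrange_coeff N j = fps_nth
     ((1 + fps_X) ^ q * (inverse (1 + fps_X) * inverse (1 - fps_X)) ^ (2 * j)) (j - 1)"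
proof -
  let ?A = "1 + fps_X :: 'a fps"
  have "?A ^ (4 * j) = ?A ^ (4 * j) * (?A ^ (2 * j) * inverse ?A ^ (2 * j))"
    by (simp add: fps_inverse_power_cancel)
  also have "\<dots> = ?A ^ (6 * j) * inverse ?A ^ (2 * j)"
    by (simp flip: power_add mult.assoc)
  finally have "?A ^ (4 * j) * inverse ?A ^ Suc N = (?A ^ Suc N * inverse ?A ^ Suc N) * ?A ^ q * inverse ?A ^ (2 * j)"
    unfolding assms power_add by (simp only: mult_ac)
  then show ?thesis
    unfolding lagrange_coeff_def
    by (simp add: fps_inverse_power_cancel power_mult_distrib mult.assoc del: power_Suc)
qed

text \<open>Here the denominator has too many factors \<open>1 + fps_X\<close>; pairing them with
  further factors \<open>1 - fps_X\<close> costs a numerator with alternating signs.\<close>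

lemma lagrange_coeff_eq2:
  assumes "Suc N = 6 * j + m"
  shows "lagrange_coeff N j = fps_nth
     ((1 - fps_X) ^ m * (inverse (1 + fps_X) * inverse (1 - fps_X)) ^ (2 * j + m)) (j - 1)"
proof -
  let ?A = "1 + fps_X :: 'a fps" and ?B = "1 - fps_X :: 'a fps"
  have "6 * j + m = 4 * j + (2 * j + m)" by simp
  then have "?A ^ (4 * j) * inverse ?A ^ Suc N = (?A ^ (4 * j) * inverse ?A ^ (4 * j)) * inverse ?A ^ (2 * j + m)"
    unfolding assms by (simp only: power_add mult.assoc)
  then have 1: "?A ^ (4 * j) * inverse ?A ^ Suc N = inverse ?A ^ (2 * j + m)"
    by (simp only: fps_inverse_power_cancel) (simp add: fps_inverse_power_cancel del: power_Suc)
  have "?B ^ m * inverse ?B ^ (2 * j + m) = (?B ^ m * inverse ?B ^ m) * inverse ?B ^ (2 * j)"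
    by (simp only: power_add mult_ac)
  then have 2: "inverse ?B ^ (2 * j) = ?B ^ m * inverse ?B ^ (2 * j + m)"
    by (simp add: fps_inverse_power_cancel)
  show ?thesis
    unfolding lagrange_coeff_def 1 2 power_mult_distrib by (simp only: mult_ac)
qed

text \<open>It suffices to find one positive coefficient of \<open>(1 + fps_X) ^ q\<close> at an
  index of the parity of \<open>j - 1\<close>: index 0 for odd \<open>j\<close>, and index 1,
  present when \<open>q > 0\<close>, for even \<open>j\<close>.\<close>

lemma lagrange_coeff_pos1:
  assumes "6 * j = Suc N + q" "j > 0" "q > 0 \<or> odd j"
  shows "lagrange_coeff N j > (0 :: 'a::linordered_field)"
proof -
  define i :: nat where "i = (if odd j then 0 else 1)"
  have "fps_nth ((1 + fps_X) ^ q * (inverse (1 + fps_X) * inverse (1 - fps_X)) ^ (2 * j)) (j - 1) > (0 :: 'a)"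
  proof (rule even_pos_mult_nth_pos)
    show "even_pos ((inverse (1 + fps_X) * inverse (1 - fps_X) :: 'a fps) ^ (2 * j))"
      using assms(2) by (intro even_pos_power even_pos_inverse_one_minus_square) simp
    show "fps_nth ((1 + fps_X) ^ q) i > (0 :: 'a)"
      using assms(3) by (auto simp: one_plus_fps_X_power_nth i_def)
    show "i \<le> j - 1" "even (j - 1 - i)"
      using assms(2) by (auto simp: i_def elim!: evenE)
    show "fps_nth ((1 + fps_X) ^ q) l \<ge> (0 :: 'a)" for l
      by (simp add: one_plus_fps_X_power_nth)
  qed
  then show ?thesis
    by (simp only: lagrange_coeff_eq1[OF assms(1)])
qed

text \<open>With \<open>q = 0\<close> only an even series remains, read at the odd index
  \<open>j - 1\<close>. This is what singles out lengths congruent to 22 modulo 24.\<close>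

lemma lagrange_coeff_zero:
  assumes "6 * j = Suc N" "j > 0" "even j"
  shows "lagrange_coeff N j = (0 :: 'a::linordered_field)"
proof -
  have "even_pos ((inverse (1 + fps_X) * inverse (1 - fps_X) :: 'a fps) ^ (2 * j))"
    using assms(2) by (intro even_pos_power even_pos_inverse_one_minus_square) simp
  then show ?thesis
    using assms even_pos_nth(2)[of "(inverse (1 + fps_X) * inverse (1 - fps_X) :: 'a fps) ^ (2 * j)" "j - 1"]
    by (subst lagrange_coeff_eq1[where q = 0]) simp_all
qed

text \<open>As \<open>j - 1\<close> is even, only even powers from \<open>(1 - fps_X) ^ m\<close>
  contribute, and those have nonnegative coefficients.\<close>

lemma lagrange_coeff_pos2:
  assumes "Suc N = 6 * j + m" "odd j"
  shows "lagrange_coeff N j > (0 :: 'a::linordered_field)"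
proof -
  have "j > 0" using assms(2) by (rule odd_pos)
  have "fps_nth ((1 - fps_X) ^ m * (inverse (1 + fps_X) * inverse (1 - fps_X)) ^ (2 * j + m)) (j - 1) > (0 :: 'a)"
  proof (rule even_pos_mult_nth_pos)
    show "even_pos ((inverse (1 + fps_X) * inverse (1 - fps_X) :: 'a fps) ^ (2 * j + m))"
      using \<open>j > 0\<close> by (intro even_pos_power even_pos_inverse_one_minus_square) simp
    show "fps_nth ((1 - fps_X) ^ m) i \<ge> (0 :: 'a)" if "i \<le> j - 1" "even (j - 1 - i)" for i
    proof -
      have "even (j - 1)" using assms(2) by simp
      then have "even i" using that by (simp only: even_diff_nat) auto
      then show ?thesis by (simp add: one_minus_fps_X_power_nth)
    qed
    show "fps_nth ((1 - fps_X) ^ m) 0 > (0 :: 'a)"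
      by (simp add: one_minus_fps_X_power_nth)
    show "0 \<le> j - 1" "even (j - 1 - 0)" using assms(2) by simp_all
  qed
  then show ?thesis
    by (simp only: lagrange_coeff_eq2[OF assms(1)])
qed

text \<open>Division by \<open>(1 + fps_X) ^ N\<close> turns the expansion into one in powers of
  \<open>fps_X * \<psi>\<close>, to which \<open>fps_Lagrange\<close> applies.\<close>

lemma weight_expansion_Lagrange:
  fixes F :: "'a::field_char_0 fps"
  assumes F: "F = (\<Sum>i\<le>R. fps_const (a i) * (1 + fps_X) ^ (N - 4 * i) * (fps_X * (1 - fps_X) ^ 2) ^ i)"
    and R: "4 * R \<le> N" and F0: "fps_nth F 0 = 1"
    and Fi: "\<And>i. 0 < i \<Longrightarrow> i < j \<Longrightarrow> fps_nth F i = 0" and j: "j > 0"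
  shows "of_nat j * (if j \<le> R then a j else 0) =
    of_nat j * fps_nth F j - of_nat N * lagrange_coeff N j"
proof -
  let ?A = "1 + fps_X :: 'a fps" and ?B = "1 - fps_X :: 'a fps"
  define \<psi> where "\<psi> = ?B ^ 2 * inverse ?A ^ 4"
  have inv: "inverse \<psi> ^ j = ?A ^ (4 * j) * inverse ?B ^ (2 * j)"
    by (simp add: \<psi>_def fps_inverse_mult fps_inverse_power power_mult_distrib mult.commute
        flip: power_mult)
  have "?A ^ (N - 4 * i) * inverse ?A ^ N = inverse ?A ^ (4 * i)" if "i \<le> R" for i
    using that R by (intro fps_power_diff_inverse) simp_all
  then have "F * inverse ?A ^ N = (\<Sum>i\<le>R. fps_const (a i) * (fps_X * \<psi>) ^ i)"
    unfolding F sum_distrib_right \<psi>_def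
    by (intro sum.cong refl) (simp add: power_mult_distrib mult_ac flip: power_mult)
  from fps_Lagrange[OF _ j _ F0 Fi this]
  have "of_nat j * (if j \<le> R then a j else 0) =
      of_nat j * fps_nth F j + fps_nth (fps_deriv (inverse ?A ^ N) * inverse \<psi> ^ j) (j - 1)"
    by (simp add: \<psi>_def fps_power_zeroth)
  also have "fps_deriv (inverse ?A ^ N) = - (of_nat N * inverse ?A ^ Suc N)"
    by (simp add: fps_deriv_inverse_power del: power_Suc)
  finally show ?thesis
    by (simp add: inv lagrange_coeff_def fps_mult_of_nat_nth(1) mult.assoc mult.left_commute del: power_Suc)
qed

text \<open>Division by \<open>(1 - fps_X) ^ (2 * R)\<close> gives an expansion in powers of
  \<open>fps_X * inverse (1 - fps_X) ^ 2\<close>. Lagrange inversion then makes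
  \<open>j * b j\<close> equal to \<open>2 * R\<close> times a coefficient of a negative power of
  \<open>1 - fps_X\<close>, which is positive. The constant term is treated separately.\<close>

lemma palindromic_fps_coeff_pos:
  fixes P :: "'a::linordered_field fps"
  assumes P: "P = (\<Sum>i\<le>R. fps_const (b i) * fps_X ^ i * (1 - fps_X) ^ (2 * (R - i)))"
    and P0: "fps_nth P 0 = 1" and Pi: "\<And>i. 0 < i \<Longrightarrow> i \<le> j \<Longrightarrow> fps_nth P i = 0" and j: "j \<le> R"
  shows "b j > 0"
proof (cases "j = 0")
  case True
  have "fps_nth P 0 = (\<Sum>i\<le>R. if i = 0 then b 0 else 0)"
    unfolding P fps_sum_nth by (intro sum.cong refl) (auto simp: fps_power_zeroth)
  with P0 True show ?thesis by simp
next
  case False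
  let ?B = "1 - fps_X :: 'a fps"
  have *: "?B ^ (2 * (R - i)) * inverse ?B ^ (2 * R) = inverse ?B ^ (2 * i)" if "i \<le> R" for i
    using that unfolding diff_mult_distrib2 by (intro fps_power_diff_inverse) simp_all
  have "P * inverse ?B ^ (2 * R) = (\<Sum>i\<le>R. fps_const (b i) * (fps_X * inverse ?B ^ 2) ^ i)"
    unfolding P sum_distrib_right
    by (intro sum.cong refl) (simp add: power_mult_distrib * mult.assoc flip: power_mult)
  from fps_Lagrange[OF _ _ _ P0 _ this, of j] False j Pi
  have "of_nat j * b j =
      fps_nth (fps_deriv (inverse ?B ^ (2 * R)) * inverse (inverse ?B ^ 2) ^ j) (j - 1)"
    by (simp add: fps_power_zeroth)
  also have "fps_deriv (inverse ?B ^ (2 * R)) = of_nat (2 * R) * inverse ?B ^ Suc (2 * R)"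
    by (simp add: fps_deriv_inverse_power del: power_Suc of_nat_mult)
  also have "inverse (inverse ?B ^ 2) ^ j = ?B ^ (2 * j)"
    by (simp add: fps_inverse_power power_mult)
  also have "Suc (2 * R) = 2 * j + Suc (2 * (R - j))" using j by simp
  also have "inverse ?B ^ (2 * j + Suc (2 * (R - j))) * ?B ^ (2 * j) = inverse ?B ^ Suc (2 * (R - j))"
    using fps_inverse_power_cancel[of ?B "2 * j"] by (simp add: power_add mult_ac)
  then have "of_nat (2 * R) * inverse ?B ^ (2 * j + Suc (2 * (R - j))) * ?B ^ (2 * j) =
      of_nat (2 * R) * inverse ?B ^ Suc (2 * (R - j))" by (simp only: mult.assoc)
  finally have "of_nat j * b j = of_nat (2 * R) * fps_nth (inverse ?B ^ Suc (2 * (R - j))) (j - 1)"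
    by (simp only: fps_mult_of_nat_nth)
  moreover have "fps_nth (inverse ?B ^ Suc (2 * (R - j))) (j - 1) > 0"
    by (rule inverse_one_minus_fps_X_power_nth_pos) simp
  ultimately have "of_nat j * b j > 0"
    using False j by simp
  then show ?thesis
    by (simp add: zero_less_mult_iff)
qed

subsection \<open>Weight enumerators\<close>

text \<open>Induction on \<open>R\<close>: subtracting \<open>c 0\<close> times the top power of
  \<open>u - v\<close> removes both extreme terms, and the rest is \<open>u * v\<close> times a
  shorter palindromic form. The value \<open>b R\<close> is recorded because it will count shadow
  vectors of the lowest weight.\<close>

lemma palindromic_expansion:
  fixes c :: "nat \<Rightarrow> real"
  assumes "\<And>t. t \<le> 2 * R \<Longrightarrow> c (2 * R - t) = c t"
  shows "\<exists>b. b R = c 0 \<and> (\<forall>u v :: complex.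
    (\<Sum>t\<le>2 * R. of_real (c t) * u ^ (2 * R - t) * v ^ t) =
    (\<Sum>j\<le>R. of_real (b j) * (u * v) ^ (R - j) * (u - v) ^ (2 * j)))"
  using assms
proof (induction R arbitrary: c)
  case 0
  show ?case by (rule exI[of _ c]) simp
next
  case (Suc R)
  define d where "d t = c t - c 0 * (- 1) ^ t * of_nat (2 * Suc R choose t)" for t
  have pal: "d (Suc (2 * R - t)) = d (Suc t)" if "t \<le> 2 * R" for t
  proof -
    have *: "Suc (2 * R - t) = 2 * Suc R - Suc t" using that by simp
    have "c (2 * Suc R - Suc t) = c (Suc t)" using that by (intro Suc.prems) simp
    moreover have "(2 * Suc R choose (2 * Suc R - Suc t)) = (2 * Suc R choose Suc t)"
      using that by (intro binomial_symmetric[symmetric]) simp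
    moreover have "(- 1 :: real) ^ (2 * Suc R - Suc t) = (- 1) ^ Suc t"
      using that by (simp add: minus_one_power_iff del: power_Suc)
    ultimately show ?thesis unfolding * d_def by simp
  qed
  obtain b where b: "b R = d (Suc 0)" "\<And>u v :: complex.
      (\<Sum>t\<le>2 * R. of_real (d (Suc t)) * u ^ (2 * R - t) * v ^ t) =
      (\<Sum>j\<le>R. of_real (b j) * (u * v) ^ (R - j) * (u - v) ^ (2 * j))"
    using Suc.IH[of "\<lambda>t. d (Suc t)"] pal by blast
  show ?case
  proof (intro exI[of _ "b(Suc R := c 0)"] conjI allI)
    fix u v :: complex
    have d0: "d 0 = 0" "d (2 * Suc R) = 0"
      using Suc.prems[of 0] by (simp_all add: d_def)
    have "(u - v) ^ (2 * Suc R) =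
        (\<Sum>t\<le>2 * Suc R. of_nat (2 * Suc R choose t) * (- v) ^ t * u ^ (2 * Suc R - t))"
      using binomial_ring[of "- v" u "2 * Suc R"] by simp
    also have "of_real (c 0) * \<dots> = (\<Sum>t\<le>2 * Suc R.
        of_real (c 0 * (- 1) ^ t * of_nat (2 * Suc R choose t)) * u ^ (2 * Suc R - t) * v ^ t)"
      unfolding sum_distrib_left
    proof (intro sum.cong refl)
      fix t
      have "(- v) ^ t = (- 1) ^ t * v ^ t" by (rule power_minus)
      then show "complex_of_real (c 0) * (of_nat (2 * Suc R choose t) * (- v) ^ t * u ^ (2 * Suc R - t)) =
          of_real (c 0 * (- 1) ^ t * of_nat (2 * Suc R choose t)) * u ^ (2 * Suc R - t) * v ^ t"
        by (simp only: of_real_mult of_real_power of_real_minus of_real_1 of_real_of_nat_eq mult_ac)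
    qed
    finally have "(\<Sum>t\<le>2 * Suc R. of_real (c t) * u ^ (2 * Suc R - t) * v ^ t) -
        of_real (c 0) * (u - v) ^ (2 * Suc R) =
        (\<Sum>t\<le>2 * Suc R. of_real (d t) * u ^ (2 * Suc R - t) * v ^ t)"
      by (simp add: d_def algebra_simps del: sum.atMost_Suc mult_Suc_right flip: sum_subtractf)
    also have "\<dots> = (\<Sum>t\<le>2 * R. of_real (d (Suc t)) * u ^ (2 * Suc R - Suc t) * v ^ Suc t)"
    proof -
      have R: "2 * Suc R = Suc (Suc (2 * R))" by simp
      show ?thesis using d0 unfolding R
        by (subst sum.atMost_Suc, subst sum.atMost_Suc_shift) simp
    qed
    also have "\<dots> = u * v * (\<Sum>t\<le>2 * R. of_real (d (Suc t)) * u ^ (2 * R - t) * v ^ t)"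
      unfolding sum_distrib_left
    proof (intro sum.cong refl)
      fix t assume "t \<in> {..2 * R}"
      then have *: "2 * Suc R - Suc t = Suc (2 * R - t)" by auto
      show "of_real (d (Suc t)) * u ^ (2 * Suc R - Suc t) * v ^ Suc t =
        u * v * (of_real (d (Suc t)) * u ^ (2 * R - t) * v ^ t)"
        unfolding * by simp
    qed
    also have "\<dots> = (\<Sum>j\<le>R. of_real (b j) * (u * v) ^ (Suc R - j) * (u - v) ^ (2 * j))"
      unfolding b(2) sum_distrib_left by (intro sum.cong refl) (simp add: Suc_diff_le)
    finally show "(\<Sum>t\<le>2 * Suc R. of_real (c t) * u ^ (2 * Suc R - t) * v ^ t) =
      (\<Sum>j\<le>Suc R. of_real ((b(Suc R := c 0)) j) * (u * v) ^ (Suc R - j) * (u - v) ^ (2 * j))"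
      by (simp add: algebra_simps del: mult_Suc_right)
  qed simp
qed

text \<open>The all-one vector is orthogonal to \<open>C\<close> because all weights in
  \<open>C\<close> are even. This is the source of the palindromic symmetry.\<close>

lemma gen_shadow_complement:
  fixes C :: "(bit ^ 'n::finite) set"
  assumes C: "self_dual_code C" and v: "v \<in> gen_shadow C"
  shows "v + 1 \<in> gen_shadow C"
proof -
  have "dot 1 c = 0" if "c \<in> C" for c
    using self_dual_even_wt[OF C that] by (simp add: dot_one of_nat_bit_eq_0_iff)
  then show ?thesis using v by (simp add: gen_shadow_def dot_add_left)
qed

lemma wt_complement: "wt (v + 1) = CARD('n) - wt v" for v :: "bit ^ 'n::finite"
proof -
  have "overlap v 1 = wt v" "wt (1 :: bit ^ 'n) = CARD('n)"
    by (simp_all add: overlap_def wt_def)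
  then show ?thesis using wt_add[of v 1] by simp
qed

text \<open>By \<open>gen_shadow_wt_mod_4\<close> and complementation the weights are
  \<open>s + 4 * t\<close> with \<open>t \<le> 2 * R\<close>, symmetrically distributed. The
  enumerator is thus \<open>(x * z) ^ s\<close> times a palindromic form in \<open>x ^ 4\<close> and
  \<open>z ^ 4\<close>.\<close>

lemma gen_shadow_expansion:
  fixes C :: "(bit ^ 'n::finite) set"
  assumes C: "self_dual_code C" and n: "CARD('n) = 2 * N" and N: "N = s + 4 * R"
    and s: "\<And>v. v \<in> gen_shadow C \<Longrightarrow> s \<le> wt v"
  obtains b :: "nat \<Rightarrow> real" where
    "b R = real (card {v \<in> gen_shadow C. wt v = s})"
    "\<And>x z :: complex. (\<Sum>v\<in>gen_shadow C. x ^ (CARD('n) - wt v) * z ^ wt v) =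
      (x * z) ^ s * (\<Sum>j\<le>R. of_real (b j) * (x ^ 4 * z ^ 4) ^ (R - j) * (x ^ 4 - z ^ 4) ^ (2 * j))"
proof -
  let ?S = "gen_shadow C"
  define \<tau> where "\<tau> v = (wt v - s) div 4" for v :: "bit ^ 'n"
  define c where "c t = card {v \<in> ?S. wt v = s + 4 * t}" for t
  have wt: "wt v = s + 4 * \<tau> v" "\<tau> v \<le> 2 * R" if v: "v \<in> ?S" for v
  proof -
    have "wt v mod 4 = s mod 4"
      using gen_shadow_wt_mod_4[OF C n v] by (simp add: N)
    then have "4 dvd wt v - s" using s[OF v] by (simp add: mod_eq_dvd_iff_nat)
    then show 1: "wt v = s + 4 * \<tau> v" using s[OF v] by (simp add: \<tau>_def)
    have "s \<le> CARD('n) - wt v"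
      using s[OF gen_shadow_complement[OF C v]] by (simp add: wt_complement)
    with 1 show "\<tau> v \<le> 2 * R" using wt_le[of v] n N by linarith
  qed
  have pal: "c (2 * R - t) = c t" if t: "t \<le> 2 * R" for t
  proof -
    have "bij_betw (\<lambda>v. v + 1) {v \<in> ?S. wt v = s + 4 * (2 * R - t)} {v \<in> ?S. wt v = s + 4 * t}"
      by (rule bij_betwI[where g = "\<lambda>v. v + 1"])
        (use n N t in \<open>auto simp: gen_shadow_complement[OF C] wt_complement add.assoc\<close>)
    then show ?thesis unfolding c_def by (rule bij_betw_same_card)
  qed
  obtain b where b: "b R = real (c 0)" "\<And>u v :: complex.
      (\<Sum>t\<le>2 * R. of_real (real (c t)) * u ^ (2 * R - t) * v ^ t) =
      (\<Sum>j\<le>R. of_real (b j) * (u * v) ^ (R - j) * (u - v) ^ (2 * j))"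
    using palindromic_expansion[of R "\<lambda>t. real (c t)"] pal by auto
  show thesis
  proof (rule that[of b])
    show "b R = real (card {v \<in> ?S. wt v = s})"
      using b(1) by (simp add: c_def)
  next
    fix x z :: complex
    let ?f = "\<lambda>v :: bit ^ 'n. x ^ (CARD('n) - wt v) * z ^ wt v"
    have "sum ?f ?S = (\<Sum>t\<le>2 * R. \<Sum>v | v \<in> ?S \<and> \<tau> v = t. ?f v)"
      by (rule sum.group[symmetric]) (auto simp: wt)
    also have "\<dots> = (\<Sum>t\<le>2 * R. (x * z) ^ s * (of_real (real (c t)) * (x ^ 4) ^ (2 * R - t) * (z ^ 4) ^ t))"
    proof (intro sum.cong refl)
      fix t assume "t \<in> {..2 * R}"
      then have t: "CARD('n) - (s + 4 * t) = s + 4 * (2 * R - t)" using n N by simp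
      have "{v. v \<in> ?S \<and> \<tau> v = t} = {v \<in> ?S. wt v = s + 4 * t}"
        using wt(1) by auto
      then have "(\<Sum>v | v \<in> ?S \<and> \<tau> v = t. ?f v) = of_nat (c t) * (x ^ (s + 4 * (2 * R - t)) * z ^ (s + 4 * t))"
        by (simp add: c_def t)
      also have "\<dots> = (x * z) ^ s * (of_real (real (c t)) * (x ^ 4) ^ (2 * R - t) * (z ^ 4) ^ t)"
        unfolding power_add power_mult power_mult_distrib of_real_of_nat_eq by (simp only: mult_ac)
      finally show "(\<Sum>v | v \<in> ?S \<and> \<tau> v = t. ?f v) =
        (x * z) ^ s * (of_real (real (c t)) * (x ^ 4) ^ (2 * R - t) * (z ^ 4) ^ t)" .
    qed
    finally show "sum ?f ?S =
      (x * z) ^ s * (\<Sum>j\<le>R. of_real (b j) * (x ^ 4 * z ^ 4) ^ (R - j) * (x ^ 4 - z ^ 4) ^ (2 * j))"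
      unfolding b(2)[symmetric] sum_distrib_left .
  qed
qed

text \<open>The identities below are obtained at squares and fourth powers of real numbers, hence
  only at nonnegative arguments.\<close>

lemma poly_eqI_nonneg:
  fixes p q :: "real poly"
  assumes "\<And>x. x \<ge> 0 \<Longrightarrow> poly p x = poly q x"
  shows "p = q"
proof (rule ccontr)
  assume "p \<noteq> q"
  then have "finite {x. poly (p - q) x = 0}" by (intro poly_roots_finite) simp
  moreover have "{0..} \<subseteq> {x. poly (p - q) x = 0}" using assms by auto
  ultimately have "finite {0 :: real..}" by (rule rev_finite_subset)
  then show False using infinite_Ici by blast
qed

lemma fps_of_poly_one_plus_X: "fps_of_poly [:1, 1 :: 'a::field:] = 1 + fps_X"
  by (simp add: fps_of_poly_linear')

lemma fps_of_poly_one_minus_X: "fps_of_poly [:1, - 1 :: 'a::field:] = 1 - fps_X"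
  unfolding fps_of_poly_linear' by (simp flip: fps_const_neg)

text \<open>Only even weights are recorded: the variable stands for \<open>y\<^sup>2\<close>.\<close>

definition half_enum :: "(bit ^ 'n::finite) set \<Rightarrow> real poly" where
  "half_enum C = (\<Sum>c\<in>C. monom 1 (wt c div 2))"

lemma coeff_half_enum:
  assumes "self_dual_code C"
  shows "coeff (half_enum C) i = real (card {c \<in> C. wt c = 2 * i})"
proof -
  have "{c \<in> C. wt c div 2 = i} = {c \<in> C. wt c = 2 * i}"
    using self_dual_even_wt[OF assms] by auto
  then show ?thesis
    by (simp add: half_enum_def coeff_sum sum.If_cases Int_def)
qed

lemma half_enum_0:
  assumes "self_dual_code C"
  shows "coeff (half_enum C) 0 = 1"
proof -
  have "{c \<in> C. wt c = 0} = {0}"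
    using linear_code_0[OF self_dual_codeD(1)[OF assms]] by (auto simp: wt_eq_0_iff)
  then show ?thesis by (simp add: coeff_half_enum[OF assms])
qed

text \<open>
  The shadow transform is evaluated at \<open>x = 1 - \<i> y\<close>, \<open>z = 1 + \<i> y\<close>, where
  \<open>x z = 1 + y\<^sup>2\<close> and \<open>(x ^ 4 - z ^ 4)\<^sup>2 = - 64 y\<^sup>2 (1 - y\<^sup>2)\<^sup>2\<close>.
\<close>

lemma half_enum_expansion:
  fixes C :: "(bit ^ 'n::finite) set" and b :: "nat \<Rightarrow> real"
  assumes C: "self_dual_code C" and n: "CARD('n) = 2 * N" and N: "N = s + 4 * R"
    and b: "\<And>x z :: complex. (\<Sum>v\<in>gen_shadow C. x ^ (CARD('n) - wt v) * z ^ wt v) =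
      (x * z) ^ s * (\<Sum>j\<le>R. of_real (b j) * (x ^ 4 * z ^ 4) ^ (R - j) * (x ^ 4 - z ^ 4) ^ (2 * j))"
    and a: "\<And>j. a j = real (card C) / 2 ^ CARD('n) * b j * (- 64) ^ j"
  shows "fps_of_poly (half_enum C) =
    (\<Sum>i\<le>R. fps_const (a i) * (1 + fps_X) ^ (N - 4 * i) * (fps_X * (1 - fps_X) ^ 2) ^ i)"
proof -
  define G where "G = (\<Sum>i\<le>R. [:a i:] * [:1, 1:] ^ (N - 4 * i) * ([:0, 1:] * [:1, - 1:] ^ 2) ^ i)"
  have "poly (half_enum C) (y ^ 2) = poly G (y ^ 2)" for y :: real
  proof -
    define x z :: complex where "x = 1 - \<i> * y" and "z = 1 + \<i> * y"
    have xz: "x * z = of_real (1 + y ^ 2)" "x + z = 2" "x - z = - 2 * \<i> * y"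
      by (simp_all add: x_def z_def algebra_simps power2_eq_square)
    have "x ^ 4 - z ^ 4 = (x - z) * (x + z) * ((x + z) ^ 2 - 2 * (x * z))"
      by (simp add: algebra_simps power2_eq_square power4_eq_xxxx)
    also have "\<dots> = - 8 * \<i> * y * of_real (1 - y ^ 2)"
      unfolding xz by (simp add: algebra_simps)
    finally have x4: "(x ^ 4 - z ^ 4) ^ 2 = of_real (- 64 * (y ^ 2 * (1 - y ^ 2) ^ 2))"
      by (simp add: power_mult_distrib)
    \<comment> \<open>The sign in the shadow transform cancels the sign of the even power of
      \<open>x - z\<close>, so each codeword contributes a real monomial in
      \<open>y ^ 2\<close>.\<close>
    have "(- 1) ^ (wt c div 2) * ((x + z) ^ (CARD('n) - wt c) * (x - z) ^ wt c) =
        2 ^ CARD('n) * of_real ((y ^ 2) ^ (wt c div 2))" if c: "c \<in> C" for c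
    proof -
      obtain h where h: "wt c = 2 * h" using self_dual_even_wt[OF C c] by blast
      have "(x - z) ^ wt c = (- 1) ^ h * (2 ^ wt c * of_real ((y ^ 2) ^ h))"
      proof -
        have "(x - z) ^ wt c = ((- 2 * \<i> * y) ^ 2) ^ h"
          by (simp only: xz h power_mult)
        also have "(- 2 * \<i> * y) ^ 2 = (- 1) * (2 ^ 2 * of_real (y ^ 2))"
          by (simp add: power_mult_distrib)
        finally show ?thesis by (simp only: power_mult_distrib h power_mult of_real_power)
      qed
      moreover have "(2 :: complex) ^ (CARD('n) - wt c) * 2 ^ wt c = 2 ^ CARD('n)"
        using wt_le[of c] by (simp flip: power_add)
      moreover have "(- 1 :: complex) ^ h * (- 1) ^ h = 1"
        by (simp flip: power_add mult_2)
      ultimately show ?thesis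
        unfolding xz(2) using h by (simp add: mult_ac)
    qed
    then have "of_nat (card C) * (\<Sum>v\<in>gen_shadow C. x ^ (CARD('n) - wt v) * z ^ wt v) =
        (\<Sum>c\<in>C. 2 ^ CARD('n) * of_real ((y ^ 2) ^ (wt c div 2)))"
      unfolding gen_shadow_transform[OF C] by (intro sum.cong refl)
    also have "\<dots> = 2 ^ CARD('n) * of_real (poly (half_enum C) (y ^ 2))"
      by (simp add: half_enum_def poly_sum poly_monom sum_distrib_left)
    finally have "of_nat (card C) * (\<Sum>v\<in>gen_shadow C. x ^ (CARD('n) - wt v) * z ^ wt v) =
        2 ^ CARD('n) * of_real (poly (half_enum C) (y ^ 2))" .
    moreover have "(\<Sum>v\<in>gen_shadow C. x ^ (CARD('n) - wt v) * z ^ wt v) =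
        of_real ((1 + y ^ 2) ^ s * (\<Sum>j\<le>R. b j * ((1 + y ^ 2) ^ 4) ^ (R - j) *
          (- 64 * (y ^ 2 * (1 - y ^ 2) ^ 2)) ^ j))"
      unfolding b power_mult x4 power_mult_distrib[of x z 4, symmetric] xz(1)
      by (simp only: of_real_mult of_real_sum of_real_power)
    ultimately have "complex_of_real (card C * ((1 + y ^ 2) ^ s * (\<Sum>j\<le>R. b j * ((1 + y ^ 2) ^ 4) ^ (R - j) *
          (- 64 * (y ^ 2 * (1 - y ^ 2) ^ 2)) ^ j))) = of_real (2 ^ CARD('n) * poly (half_enum C) (y ^ 2))"
      by simp
    then have *: "2 ^ CARD('n) * poly (half_enum C) (y ^ 2) = card C * ((1 + y ^ 2) ^ s *
        (\<Sum>j\<le>R. b j * ((1 + y ^ 2) ^ 4) ^ (R - j) * (- 64 * (y ^ 2 * (1 - y ^ 2) ^ 2)) ^ j))"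
      by (simp only: of_real_eq_iff)
    have "2 ^ CARD('n) * (a j * (1 + y ^ 2) ^ (N - 4 * j) * (y ^ 2 * (1 - y ^ 2) ^ 2) ^ j) =
        card C * ((1 + y ^ 2) ^ s * (b j * ((1 + y ^ 2) ^ 4) ^ (R - j) * (- 64 * (y ^ 2 * (1 - y ^ 2) ^ 2)) ^ j))"
      if "j \<le> R" for j
    proof -
      have "N - 4 * j = s + 4 * (R - j)" using N that by simp
      then have 1: "(1 + y ^ 2) ^ (N - 4 * j) = (1 + y ^ 2) ^ s * ((1 + y ^ 2) ^ 4) ^ (R - j)"
        by (simp add: power_add power_mult)
      have 2: "2 ^ CARD('n) * a j = card C * b j * (- 64) ^ j"
        by (simp add: a)
      have "2 ^ CARD('n) * (a j * (1 + y ^ 2) ^ (N - 4 * j) * (y ^ 2 * (1 - y ^ 2) ^ 2) ^ j) =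
          2 ^ CARD('n) * a j * (1 + y ^ 2) ^ (N - 4 * j) * (y ^ 2 * (1 - y ^ 2) ^ 2) ^ j"
        by (simp only: mult.assoc)
      then show ?thesis
        unfolding 1 2 power_mult_distrib[of "- 64"] by (simp only: mult_ac)
    qed
    moreover have G: "poly G (y ^ 2) =
        (\<Sum>j\<le>R. a j * (1 + y ^ 2) ^ (N - 4 * j) * (y ^ 2 * (1 - y ^ 2) ^ 2) ^ j)"
      by (simp add: G_def poly_sum mult.assoc)
    ultimately have "2 ^ CARD('n) * poly G (y ^ 2) = card C * ((1 + y ^ 2) ^ s *
        (\<Sum>j\<le>R. b j * ((1 + y ^ 2) ^ 4) ^ (R - j) * (- 64 * (y ^ 2 * (1 - y ^ 2) ^ 2)) ^ j))"
      unfolding G sum_distrib_left by (intro sum.cong refl) (simp only: atMost_iff)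
    with * have "2 ^ CARD('n) * poly (half_enum C) (y ^ 2) = 2 ^ CARD('n) * poly G (y ^ 2)"
      by (simp only:)
    then show ?thesis by simp
  qed
  then have "poly (half_enum C) x = poly G x" if "x \<ge> 0" for x
    using that by (metis real_sqrt_pow2)
  then have "half_enum C = G" by (rule poly_eqI_nonneg)
  then show ?thesis
    by (simp only: G_def fps_of_poly_sum fps_of_poly_mult fps_of_poly_power fps_of_poly_const
        fps_of_poly_fps_X fps_of_poly_one_plus_X fps_of_poly_one_minus_X)
qed

subsection \<open>Codes over the integers modulo 4\<close>

lemma Z4_exhaust: "(a :: 4) = 0 \<or> a = 1 \<or> a = 2 \<or> a = 3"
proof (cases a)
  case (of_int z)
  then have "z = 0 \<or> z = 1 \<or> z = 2 \<or> z = 3" by auto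
  then show ?thesis using of_int by auto
qed

lemma Z4_four: "(4 :: 4) = 0" by simp

lemma of_nat_Z4_eq_0_iff: "(of_nat m :: 4) = 0 \<longleftrightarrow> 4 dvd m"
proof -
  have "(of_nat m :: 4) = of_nat (4 * (m div 4) + m mod 4)" by simp
  also have "\<dots> = of_nat (m mod 4)"
    unfolding of_nat_add of_nat_mult by (simp add: Z4_four)
  finally have *: "(of_nat m :: 4) = of_nat (m mod 4)" .
  have "m mod 4 < 4" by simp
  then have "m mod 4 \<in> {0, 1, 2, 3}" by auto
  then show ?thesis
    unfolding * dvd_eq_mod_eq_0 by auto
qed

text \<open>The additive embedding of the binary field onto the ideal generated by 2;
  \<open>dbl_mult\<close> says that multiplying such an element only involves the other factor
  modulo 2.\<close>

definition dbl :: "bit \<Rightarrow> 4" where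
  "dbl b = (if b = 0 then 0 else 2)"

lemma dbl_0 [simp]: "dbl 0 = 0"
  by (simp add: dbl_def)

lemma dbl_add: "dbl (b + c) = dbl b + dbl c"
  by (cases b; cases c) (simp_all add: dbl_def)

lemma dbl_sum: "dbl (sum f A) = (\<Sum>i\<in>A. dbl (f i))"
  by (induction A rule: infinite_finite_induct) (simp_all add: dbl_add)

lemma dbl_mult: "dbl b * a = dbl (b * mod2 a)"
proof -
  have "(2 :: 4) * 3 = 2" using Z4_four by simp
  then show ?thesis
    using Z4_exhaust[of a] by (cases b) (auto simp: dbl_def mod2_def)
qed

lemma Z4_square: "a * a = (if mod2 a = 1 then 1 else 0)"
proof -
  have "(3 :: 4) * 3 = 1" by simp
  then show ?thesis
    using Z4_exhaust[of a] by (auto simp: mod2_def)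
qed

definition reduce :: "4 ^ 'n \<Rightarrow> bit ^ 'n" where
  "reduce c = (\<chi> i. mod2 (c $ i))"

lemma residue_code_eq: "residue_code \<C> = reduce ` \<C>"
  by (simp add: residue_code_def reduce_def)

text \<open>Odd elements square to 1 and even ones to 0, so the inner product of a codeword with
  itself is the weight of its reduction, taken modulo 4.\<close>

lemma residue_code_wt:
  assumes "self_dual_code \<C>" "c \<in> residue_code \<C>"
  shows "4 dvd wt c"
proof -
  obtain d where d: "d \<in> \<C>" "c = reduce d"
    using assms(2) by (auto simp: residue_code_eq)
  have "(0 :: 4) = dot d d"
    using self_dual_codeD(2)[OF assms(1), of d] d(1) by metis
  also have "\<dots> = of_nat (wt c)"
    unfolding dot_def Z4_square d(2) wt_def by (simp add: sum.If_cases reduce_def)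
  finally show ?thesis by (simp add: of_nat_Z4_eq_0_iff)
qed

text \<open>Doubling \<open>x\<close> coordinatewise gives a word orthogonal to \<open>\<C>\<close>,
  hence in \<open>\<C>\<close>; its entries are 0 and 2, and each 2 has Lee weight 2.\<close>

lemma torsion_wt_bound:
  fixes \<C> :: "(4 ^ 'n::finite) set"
  assumes \<C>: "self_dual_code \<C>" and x: "x \<in> dual_code (residue_code \<C>)" "x \<noteq> 0"
  shows "min_lee_weight \<C> \<le> 2 * wt x"
proof -
  define y :: "4 ^ 'n" where "y = (\<chi> i. dbl (x $ i))"
  have "dot y d = 0" if "d \<in> \<C>" for d
  proof -
    have "dot y d = dbl (dot x (reduce d))"
      by (simp add: dot_def y_def dbl_mult dbl_sum reduce_def)
    also have "dot x (reduce d) = 0"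
      using x(1) that by (auto simp: dual_code_def residue_code_eq)
    finally show ?thesis by (simp add: dbl_def)
  qed
  then have "y \<in> \<C>" using \<C> self_dual_codeD(2) by blast
  moreover have "y \<noteq> 0"
  proof -
    obtain i where "x $ i \<noteq> 0" using x(2) by (metis vec_eq_iff zero_index)
    then have "y $ i \<noteq> 0" by (simp add: y_def dbl_def)
    then show ?thesis by auto
  qed
  ultimately have "min_lee_weight \<C> \<le> lee_weight y"
    unfolding min_lee_weight_def by (intro Min_le) (auto intro!: finite_imageI finite_subset[of _ UNIV])
  also have "{i. y $ i = 1} = {}" "{i. y $ i = 2} = {i. x $ i \<noteq> 0}" "{i. y $ i = 3} = {}"
    by (auto simp: y_def dbl_def split: if_splits)
  then have "lee_weight y = 2 * wt x"
    by (simp add: lee_weight_def count_comp_def wt_def)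
  finally show ?thesis .
qed

section \<open>Torsion bounds and shadows of singly and doubly even codes\<close>

lemma even_half_iff: "even n \<Longrightarrow> even (n div 2) \<longleftrightarrow> 4 dvd (n :: nat)"
  by (auto elim!: evenE)

text \<open>Residue words lie in \<open>C\<close> and have weight divisible by 4, so vectors of
  \<open>C\<close> and of \<open>gen_shadow C\<close> alike are orthogonal to them.\<close>

lemma torsion_bound_code:
  assumes \<C>: "self_dual_code \<C>" and C: "self_dual_code C" and sub: "residue_code \<C> \<subseteq> C"
    and x: "x \<in> C \<or> x \<in> gen_shadow C" "x \<noteq> 0"
  shows "min_lee_weight \<C> \<le> 2 * wt x"
proof (rule torsion_wt_bound[OF \<C> _ x(2)])
  have "dot x c = 0" if c: "c \<in> residue_code \<C>" for c
  proof (cases "x \<in> C")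
    case True
    then show ?thesis using self_dual_codeD(2)[OF C] c sub by blast
  next
    case False
    then have "dot x c = of_nat (wt c div 2)"
      using x(1) c sub by (auto simp: gen_shadow_def)
    moreover have "even (wt c div 2)"
      using residue_code_wt[OF \<C> c] by (auto elim!: dvdE)
    ultimately show ?thesis by (simp only: of_nat_bit_eq_0_iff)
  qed
  then show "x \<in> dual_code (residue_code \<C>)" by (simp add: dual_code_def)
qed

lemma add_eq_0_iff_bit: "(a :: bit) + b = 0 \<longleftrightarrow> a = b"
  by (cases a; cases b) simp_all

text \<open>The codewords of weight divisible by 4 form the kernel of the nonzero functional given
  by half the weight. A shadow vector induces a nonzero functional on \<open>C\<close> vanishing on
  this kernel, and only one such functional exists.\<close>

lemma shadow_eq_gen_shadow:
  assumes "singly_even C"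
  shows "shadow C = gen_shadow C"
proof -
  have C: "self_dual_code C" using assms by (simp add: singly_even_def)
  obtain d where d: "d \<in> C" "wt d mod 4 = 2" using assms by (auto simp: singly_even_def)
  have half: "(of_nat (wt c div 2) :: bit) = (if wt c mod 4 = 0 then 0 else 1)" if "c \<in> C" for c
  proof -
    have ev: "even (wt c)" using C that by (rule self_dual_even_wt)
    show ?thesis
      using of_nat_bit_eq_0_iff[of "wt c div 2"] even_half_iff[OF ev]
      by (auto simp: dvd_eq_mod_eq_0)
  qed
  show ?thesis
  proof (intro equalityI subsetI)
    fix v assume v: "v \<in> shadow C"
    then have v0: "dot v c = 0" if "c \<in> C" "wt c mod 4 = 0" for c
      using that by (auto simp: shadow_def dual_code_def)
    obtain e where e: "e \<in> C" "dot v e = 1"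
      using v self_dual_codeD(2)[OF C, of v] by (auto simp: shadow_def)
    have e4: "wt e mod 4 \<noteq> 0" using v0[of e] e by auto
    have "dot v c = of_nat (wt c div 2)" if c: "c \<in> C" for c
    proof (cases "wt c mod 4 = 0")
      case True
      then show ?thesis using v0[OF c] half[OF c] by simp
    next
      case False
      \<comment> \<open>Neither \<open>c\<close> nor \<open>e\<close> has weight divisible by 4, but
        their sum does; this carries the value at \<open>e\<close> over to \<open>c\<close>.\<close>
      have ce: "c + e \<in> C" using self_dual_codeD(1)[OF C] c e(1) by (rule linear_code_add)
      have "(of_nat (wt (c + e) div 2) :: bit) = 0"
        unfolding half_wt_add[OF C c e(1)] half[OF c] half[OF e(1)] using False e4 by simp
      then have "wt (c + e) mod 4 = 0" using half[OF ce] by (auto split: if_splits)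
      then have "dot v c + dot v e = 0" using v0[OF ce] by (simp add: dot_add_right)
      then show ?thesis using e(2) half[OF c] False by (simp add: add_eq_0_iff_bit)
    qed
    then show "v \<in> gen_shadow C" by (simp add: gen_shadow_def)
  next
    fix v assume v: "v \<in> gen_shadow C"
    then have "v \<in> dual_code {c \<in> C. wt c mod 4 = 0}"
      using half by (auto simp: gen_shadow_def dual_code_def)
    moreover have "dot v d = 1"
      using v d half[OF d(1)] by (auto simp: gen_shadow_def)
    then have "v \<notin> C" using d(1) self_dual_codeD(2)[OF C, of v] by force
    ultimately show "v \<in> shadow C" by (simp add: shadow_def)
  qed
qed

lemma gen_shadow_doubly_even:
  assumes "doubly_even C"
  shows "gen_shadow C = C"
proof -
  have C: "self_dual_code C" using assms by (simp add: doubly_even_def)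
  have "(of_nat (wt c div 2) :: bit) = 0" if "c \<in> C" for c
  proof -
    have "4 dvd wt c" using assms that by (auto simp: doubly_even_def)
    then have "even (wt c div 2)" by (auto elim!: dvdE)
    then show ?thesis by (simp only: of_nat_bit_eq_0_iff)
  qed
  then have "v \<in> gen_shadow C \<longleftrightarrow> v \<in> C" for v
    by (simp add: gen_shadow_def self_dual_codeD(2)[OF C, of v])
  then show ?thesis by blast
qed

lemma singly_or_doubly_even:
  assumes "self_dual_code C"
  shows "singly_even C \<or> doubly_even C"
proof -
  have "wt c mod 4 = 2 \<or> 4 dvd wt c" if c: "c \<in> C" for c
  proof -
    obtain h where h: "wt c = 2 * h" using self_dual_even_wt[OF assms c] by blast
    show ?thesis
      unfolding h using mod_mult_mult1[of 2 h 2] by (cases "even h") (auto simp: odd_iff_mod_2_eq_one)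
  qed
  then show ?thesis using assms unfolding singly_even_def doubly_even_def by blast
qed

subsection \<open>Attained weights\<close>

text \<open>The bound on the shadow cuts the expansion off at index \<open>r\<close>. At
  \<open>r\<close> the code coefficient vanishes, which forces \<open>a r\<close> to be nonzero and
  a shadow vector of lowest weight to exist; beyond \<open>r\<close> there is no \<open>a j\<close>,
  so the Lagrange coefficient directly decides which weights occur in \<open>C\<close>.\<close>

lemma singly_even_weights:
  fixes C :: "(bit ^ 'n::finite) set"
  assumes C: "self_dual_code C" and n: "CARD('n) = 2 * (6 * r + e)" and r: "odd r" and e: "e \<le> 5"
    and d: "\<And>c. c \<in> C \<Longrightarrow> c \<noteq> 0 \<Longrightarrow> 2 * r + 2 \<le> wt c"
    and s: "\<And>v. v \<in> gen_shadow C \<Longrightarrow> 2 * r + e \<le> wt v"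
  shows "\<exists>v\<in>gen_shadow C. wt v = 2 * r + e"
    and "e \<le> 4 \<Longrightarrow> \<exists>c\<in>C. wt c = 2 * r + 2"
    and "e = 5 \<Longrightarrow> \<forall>c\<in>C. wt c \<noteq> 2 * r + 2"
    and "e = 5 \<Longrightarrow> \<exists>c\<in>C. wt c = 2 * r + 4"
proof -
  define N where "N = 6 * r + e"
  define F where "F = fps_of_poly (half_enum C)"
  have n: "CARD('n) = 2 * N" and N: "N = (2 * r + e) + 4 * r"
    using n by (simp_all add: N_def)
  from gen_shadow_expansion[OF C n N s] obtain b :: "nat \<Rightarrow> real" where
    b0: "b r = real (card {v \<in> gen_shadow C. wt v = 2 * r + e})" and
    b: "\<And>x z :: complex. (\<Sum>v\<in>gen_shadow C. x ^ (CARD('n) - wt v) * z ^ wt v) =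
      (x * z) ^ (2 * r + e) * (\<Sum>j\<le>r. of_real (b j) * (x ^ 4 * z ^ 4) ^ (r - j) * (x ^ 4 - z ^ 4) ^ (2 * j))"
    by blast
  define a where "a j = real (card C) / 2 ^ CARD('n) * b j * (- 64) ^ j" for j
  note F = half_enum_expansion[OF C n N b a_def, folded F_def]
  have F_nth: "fps_nth F i = real (card {c \<in> C. wt c = 2 * i})" for i
    by (simp add: F_def coeff_half_enum[OF C])
  have F0: "fps_nth F 0 = 1"
    by (simp add: F_def half_enum_0[OF C])
  have F_small: "fps_nth F i = 0" if "0 < i" "i \<le> r" for i
  proof -
    have "{c \<in> C. wt c = 2 * i} = {}" using d that by fastforce
    then show ?thesis unfolding F_nth by (simp only: card.empty)
  qed
  have "4 * r \<le> N" by (simp add: N)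
  note L = weight_expansion_Lagrange[OF F this F0]
  have rpos: "r > 0" using r by (rule odd_pos)
  have Npos: "real N > 0" using rpos by (simp add: N_def)
  have "real r * a r = - (real N * lagrange_coeff N r)"
    using L[of r] F_small rpos by simp
  moreover have "lagrange_coeff N r > (0 :: real)"
    by (rule lagrange_coeff_pos2[where m = "e + 1"]) (simp_all add: N_def r)
  ultimately have "a r \<noteq> 0" using Npos by auto
  then have "b r \<noteq> 0" by (auto simp: a_def)
  then have "card {v \<in> gen_shadow C. wt v = 2 * r + e} \<noteq> 0" by (simp add: b0)
  then have "{v \<in> gen_shadow C. wt v = 2 * r + e} \<noteq> {}" by (metis card.empty)
  then show "\<exists>v\<in>gen_shadow C. wt v = 2 * r + e" by blast
  \<comment> \<open>The index \<open>r + 1\<close> lies past the end of the expansion, so the left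
    side of \<open>L\<close> is 0.\<close>
  have L1: "real (r + 1) * fps_nth F (r + 1) = real N * lagrange_coeff N (r + 1)"
    using L[of "r + 1"] F_small by simp
  have exI: "\<exists>c\<in>C. wt c = 2 * i" if "real i * fps_nth F i > 0" for i
  proof -
    have "{c \<in> C. wt c = 2 * i} \<noteq> {}" using that unfolding F_nth by (metis card.empty mult_zero_right of_nat_0 order.irrefl)
    then show ?thesis by blast
  qed
  show "\<exists>c\<in>C. wt c = 2 * r + 2" if "e \<le> 4"
  proof -
    \<comment> \<open>The choice of \<open>q\<close> comes from
      \<open>6 * (r + 1) = Suc N + (5 - e)\<close>; it is positive exactly for
      \<open>e \<le> 4\<close>, and \<open>r + 1\<close> is even.\<close>
    have "lagrange_coeff N (r + 1) > (0 :: real)"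
      by (rule lagrange_coeff_pos1[where q = "5 - e"]) (use that in \<open>simp_all add: N_def\<close>)
    then show ?thesis using L1 Npos exI[of "r + 1"] by (simp add: mult_pos_pos)
  qed
  assume e5: "e = 5"
  have "lagrange_coeff N (r + 1) = (0 :: real)"
    by (rule lagrange_coeff_zero) (use e5 r in \<open>simp_all add: N_def\<close>)
  then have F1: "fps_nth F (r + 1) = 0" using L1 by simp
  have "{c \<in> C. wt c = 2 * (r + 1)} = {}"
    using F1 unfolding F_nth by simp
  then show "\<forall>c\<in>C. wt c \<noteq> 2 * r + 2" by auto
  have F_small2: "fps_nth F i = 0" if "0 < i" "i < r + 2" for i
    using F_small[of i] F1 that by (cases "i = r + 1") auto
  \<comment> \<open>The coefficient at \<open>r + 1\<close> being zero, Lagrange inversion moves one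
    index further, with \<open>6 * (r + 2) = Suc N + 6\<close>.\<close>
  have "lagrange_coeff N (r + 2) > (0 :: real)"
    by (rule lagrange_coeff_pos1[where q = 6]) (use e5 in \<open>simp_all add: N_def\<close>)
  moreover have "real (r + 2) * fps_nth F (r + 2) = real N * lagrange_coeff N (r + 2)"
    using L[of "r + 2"] F_small2 by simp
  ultimately have "\<exists>c\<in>C. wt c = 2 * (r + 2)"
    using Npos by (intro exI) simp
  moreover have "2 * (r + 2) = 2 * r + 4" by simp
  ultimately show "\<exists>c\<in>C. wt c = 2 * r + 4" by (simp only:)
qed

text \<open>
  A doubly even code is its own generalized shadow, so the same coefficient can be computed from
  either end of the expansion; without words of weight \<open>4 k + 4\<close> the two signs disagree.
\<close>

lemma doubly_even_weight:
  fixes C :: "(bit ^ 'n::finite) set"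
  assumes de: "doubly_even C" and n: "CARD('n) = 24 * k + 16"
    and d: "\<And>c. c \<in> C \<Longrightarrow> c \<noteq> 0 \<Longrightarrow> 4 * k + 4 \<le> wt c"
  shows "\<exists>c\<in>C. wt c = 4 * k + 4"
proof (rule ccontr)
  assume none: "\<not> (\<exists>c\<in>C. wt c = 4 * k + 4)"
  have C: "self_dual_code C" using de by (simp add: doubly_even_def)
  have dvd: "4 dvd wt c" if "c \<in> C" for c
    using de that by (simp add: doubly_even_def)
  have gs: "gen_shadow C = C" using de by (rule gen_shadow_doubly_even)
  define N R where "N = 12 * k + 8" and "R = 3 * k + 2"
  have n: "CARD('n) = 2 * N" and N: "N = 0 + 4 * R"
    using n by (simp_all add: N_def R_def)
  from gen_shadow_expansion[OF C n N zero_le] obtain b :: "nat \<Rightarrow> real" where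
    "b R = real (card {v \<in> gen_shadow C. wt v = 0})" and
    b: "\<And>x z :: complex. (\<Sum>v\<in>gen_shadow C. x ^ (CARD('n) - wt v) * z ^ wt v) =
      (x * z) ^ 0 * (\<Sum>j\<le>R. of_real (b j) * (x ^ 4 * z ^ 4) ^ (R - j) * (x ^ 4 - z ^ 4) ^ (2 * j))"
    by blast
  \<comment> \<open>One end of the expansion: with \<open>x = 1\<close> it gives the enumerator of
    \<open>C\<close> in the variable \<open>z ^ 4\<close>, and reversing the order of summation puts
    the coefficients \<open>b (R - j)\<close> in front.\<close>
  define P :: "real poly" where "P = (\<Sum>c\<in>C. monom 1 (wt c div 4))"
  define Q where "Q = (\<Sum>j\<le>R. [:b (R - j):] * [:0, 1:] ^ j * [:1, - 1:] ^ (2 * (R - j)))"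
  have "poly P (z ^ 4) = poly Q (z ^ 4)" for z :: real
  proof -
    have "complex_of_real (poly P (z ^ 4)) = (\<Sum>v\<in>gen_shadow C. 1 ^ (CARD('n) - wt v) * of_real z ^ wt v)"
      unfolding gs P_def poly_sum of_real_sum
      by (intro sum.cong refl) (use dvd in \<open>simp add: poly_monom flip: power_mult\<close>)
    also have "\<dots> = of_real (\<Sum>j\<le>R. b j * (z ^ 4) ^ (R - j) * (1 - z ^ 4) ^ (2 * j))"
      unfolding b by simp
    also have "(\<Sum>j\<le>R. b j * (z ^ 4) ^ (R - j) * (1 - z ^ 4) ^ (2 * j)) =
        (\<Sum>j\<le>R. b (R - j) * (z ^ 4) ^ j * (1 - z ^ 4) ^ (2 * (R - j)))"
      by (rule sum.reindex_bij_witness[where i = "\<lambda>j. R - j" and j = "\<lambda>j. R - j"]) auto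
    also have "\<dots> = poly Q (z ^ 4)"
      by (simp add: Q_def poly_sum mult.assoc)
    finally show ?thesis by (simp only: of_real_eq_iff)
  qed
  then have "poly P x = poly Q x" if "x \<ge> 0" for x
    using that by (metis real_root_pow_pos2 zero_less_numeral)
  then have "P = Q" by (rule poly_eqI_nonneg)
  then have P: "fps_of_poly P =
      (\<Sum>i\<le>R. fps_const (b (R - i)) * fps_X ^ i * (1 - fps_X) ^ (2 * (R - i)))"
    by (simp only: Q_def fps_of_poly_sum fps_of_poly_mult fps_of_poly_power fps_of_poly_const
        fps_of_poly_fps_X fps_of_poly_one_minus_X)
  have P_nth: "fps_nth (fps_of_poly P) i = real (card {c \<in> C. wt c = 4 * i})" for i
  proof -
    have "{c \<in> C. wt c div 4 = i} = {c \<in> C. wt c = 4 * i}"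
      using dvd by auto
    then show ?thesis
      by (simp add: P_def coeff_sum sum.If_cases Int_def)
  qed
  \<comment> \<open>The index is chosen because \<open>R - k = 2 * k + 2\<close>, which is the
    \<open>j\<close> used at the other end.\<close>
  have "b (R - k) > 0"
  proof (rule palindromic_fps_coeff_pos[OF P])
    have "{c \<in> C. wt c = 0} = {0}"
      using linear_code_0[OF self_dual_codeD(1)[OF C]] by (auto simp: wt_eq_0_iff)
    then show "fps_nth (fps_of_poly P) 0 = 1" using P_nth[of 0] by simp
  next
    fix i assume "0 < i" "i \<le> k"
    then have "{c \<in> C. wt c = 4 * i} = {}" using d by fastforce
    then show "fps_nth (fps_of_poly P) i = 0" unfolding P_nth by (simp only: card.empty)
  qed (simp add: R_def)
  define F where "F = fps_of_poly (half_enum C)"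
  define a where "a j = real (card C) / 2 ^ CARD('n) * b j * (- 64) ^ j" for j
  define j where "j = 2 * k + 2"
  note F = half_enum_expansion[OF C n N b a_def, folded F_def]
  have F0: "fps_nth F 0 = 1"
    by (simp add: F_def half_enum_0[OF C])
  \<comment> \<open>The range includes \<open>j\<close> itself, that is weight
    \<open>4 * k + 4\<close>, which is excluded by \<open>none\<close>.\<close>
  have F_small: "fps_nth F i = 0" if "0 < i" "i \<le> j" for i
  proof -
    have "wt c \<noteq> 2 * i" if c: "c \<in> C" for c
    proof (cases "c = 0")
      case False
      then show ?thesis using d[OF c] none c \<open>i \<le> j\<close> by (force simp: j_def)
    qed (use \<open>0 < i\<close> in simp)
    then have "{c \<in> C. wt c = 2 * i} = {}" by blast
    then show ?thesis by (simp add: F_def coeff_half_enum[OF C])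
  qed
  have "4 * R \<le> N" by (simp add: N)
  from weight_expansion_Lagrange[OF F this F0, of j]
  have "real j * a j = - (real N * lagrange_coeff N j)"
    using F_small by (simp add: j_def R_def)
  moreover have "lagrange_coeff N j > (0 :: real)"
    by (rule lagrange_coeff_pos1[where q = 3]) (simp_all add: N_def j_def)
  ultimately have "real j * a j < 0"
    by (simp add: N_def)
  \<comment> \<open>The exponent \<open>j = 2 * k + 2\<close> is even, so \<open>(- 64) ^ j\<close>
    is positive and \<open>a j\<close> inherits the sign of \<open>b (R - k)\<close>.\<close>
  moreover have "a j \<ge> 0"
  proof -
    have "R - k = j" by (simp add: R_def j_def)
    with \<open>b (R - k) > 0\<close> show ?thesis by (simp add: a_def j_def)
  qed
  ultimately show False by (simp add: mult_less_0_iff)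
qed

section \<open>Minimum weights and the three cases of the theorem\<close>

lemma min_weight_eqI:
  assumes "\<And>c. c \<in> C \<Longrightarrow> c \<noteq> 0 \<Longrightarrow> m \<le> wt c" "\<exists>c\<in>C. wt c = m" "m > 0"
  shows "min_weight C = m"
proof -
  obtain c where c: "c \<in> C" "wt c = m" using assms(2) by blast
  then have "c \<noteq> 0" using assms(3) by auto
  then show ?thesis
    unfolding min_weight_def using c assms(1) by (intro Min_eqI) auto
qed

theorem proposition5p2:
  fixes k \<alpha> \<beta> :: nat
    and \<C> :: "(4 ^ 'n::finite) set"
    and C :: "(bit ^ 'n) set"
  assumes "self_dual_code \<C>"
    and "CARD('n) = 24 * k + \<alpha>"
    and "min_lee_weight \<C> = 8 * k + \<beta>"
    and "self_dual_code C"
    and "residue_code \<C> \<subseteq> C"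
  shows
    "((\<alpha>, \<beta>) \<in> {(14, 6), (18, 8), (20, 8)} \<longrightarrow>
        s_extremal C \<and> min_weight C = 4 * k + 4) \<and>
     ((\<alpha>, \<beta>) = (16, 8) \<longrightarrow>
        (singly_even C \<longrightarrow> s_extremal C \<and> min_weight C = 4 * k + 4) \<and>
        (doubly_even C \<longrightarrow> extremal C)) \<and>
     ((\<alpha>, \<beta>) = (22, 8) \<longrightarrow>
        s_extremal C \<and> (min_weight C = 4 * k + 4 \<or> min_weight C = 4 * k + 6))"
proof -
  note C = \<open>self_dual_code C\<close>
  have bound: "8 * k + \<beta> \<le> 2 * wt x" if "x \<in> C \<or> x \<in> gen_shadow C" "x \<noteq> 0" for x
    using torsion_bound_code[OF assms(1,4,5) that] by (simp add: assms(3))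
  \<comment> \<open>The torsion bound gives at least \<open>4 * k + 3\<close>; evenness of the
    weight supplies the last unit.\<close>
  have dmin: "4 * k + 4 \<le> wt c" if "\<beta> \<ge> 6" "c \<in> C" "c \<noteq> 0" for c
  proof -
    obtain h where h: "wt c = 2 * h" using self_dual_even_wt[OF C \<open>c \<in> C\<close>] by blast
    have "8 * k + 6 \<le> 4 * h" using bound[of c] that h by simp
    then show ?thesis unfolding h by presburger
  qed
  \<comment> \<open>The lengths are written as \<open>24 * k + 12 + 2 * e\<close> with
    \<open>e\<close> from 1 to 5, so that half the length is \<open>6 * r + e\<close> with
    \<open>r = 2 * k + 1\<close>.\<close>
  have main: "shadow_min_weight C = 4 * k + 2 + e"
      "e \<le> 4 \<Longrightarrow> min_weight C = 4 * k + 4" "e = 5 \<Longrightarrow> min_weight C = 4 * k + 6"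
    if se: "singly_even C" and \<alpha>: "\<alpha> = 12 + 2 * e" and e: "1 \<le> e" "e \<le> 5"
      and \<beta>: "\<beta> \<ge> 6" "e \<ge> 2 \<Longrightarrow> \<beta> \<ge> 8" for e
  proof -
    define r where "r = 2 * k + 1"
    have n: "CARD('n) = 2 * (6 * r + e)" using assms(2) \<alpha> by (simp add: r_def)
    have sh: "shadow C = gen_shadow C" using se by (rule shadow_eq_gen_shadow)
    have "0 \<notin> gen_shadow C"
      unfolding sh[symmetric] using linear_code_0[OF self_dual_codeD(1)[OF C]] by (simp add: shadow_def)
    have s: "2 * r + e \<le> wt v" if v: "v \<in> gen_shadow C" for v
    proof -
      have v0: "v \<noteq> 0" using v \<open>0 \<notin> gen_shadow C\<close> by auto
      have b: "8 * k + \<beta> \<le> 2 * wt v" using bound v v0 by blast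
      have "wt v mod 4 = (6 * r + e) mod 4"
        using gen_shadow_wt_mod_4[OF C n v] .
      also have "6 * r + e = 4 * (r + k) + (2 + e)" by (simp add: r_def)
      also have "\<dots> mod 4 = (2 + e) mod 4" by (rule mod_mult_self4)
      finally have m: "wt v mod 4 = (2 + e) mod 4" .
      have "wt v = 4 * (wt v div 4) + wt v mod 4" by simp
      then obtain q where q: "wt v = 4 * q + (2 + e) mod 4" unfolding m by blast
      \<comment> \<open>In each case \<open>4 * k + 2 + e\<close> is the least number in the residue
        class of \<open>2 + e\<close> modulo 4 that meets the torsion bound.\<close>
      have "e = 1 \<or> e = 2 \<or> e = 3 \<or> e = 4 \<or> e = 5" using e by auto
      then show ?thesis
        using b \<beta> unfolding r_def q by (elim disjE; simp; presburger)
    qed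
    have d: "2 * r + 2 \<le> wt c" if "c \<in> C" "c \<noteq> 0" for c
      using dmin[OF \<beta>(1) that] by (simp add: r_def)
    have r: "odd r" by (simp add: r_def)
    have W1: "\<exists>v\<in>gen_shadow C. wt v = 2 * r + e"
      by (rule singly_even_weights(1)[OF C n r e(2) d s])
    have W2: "\<exists>c\<in>C. wt c = 2 * r + 2" if "e \<le> 4"
      by (rule singly_even_weights(2)[OF C n r e(2) d s that])
    have W3: "\<forall>c\<in>C. wt c \<noteq> 2 * r + 2" and W4: "\<exists>c\<in>C. wt c = 2 * r + 4" if "e = 5"
      by (rule singly_even_weights(3,4)[OF C n r e(2) d s that]; assumption)+
    have "Min (wt ` gen_shadow C) = 2 * r + e"
      using W1 s by (intro Min_eqI) (auto simp: image_iff intro: sym)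
    then show "shadow_min_weight C = 4 * k + 2 + e"
      by (simp add: shadow_min_weight_def sh r_def)
    show "min_weight C = 4 * k + 4" if "e \<le> 4"
    proof -
      have eq: "4 * k + 4 = 2 * r + 2" by (simp add: r_def)
      show ?thesis
        unfolding eq by (rule min_weight_eqI) (use d W2[OF that] in auto)
    qed
    \<comment> \<open>Weight \<open>4 * k + 4\<close> does not occur for \<open>e = 5\<close>, and
      weights are even, so the next candidate is \<open>4 * k + 6\<close>.\<close>
    show "min_weight C = 4 * k + 6" if "e = 5"
    proof (rule min_weight_eqI)
      fix c assume c: "c \<in> C" "c \<noteq> 0"
      obtain h where h: "wt c = 2 * h" using self_dual_even_wt[OF C c(1)] by blast
      have "2 * h \<noteq> 2 * r + 2" using W3[OF that] c(1) h by metis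
      moreover have "2 * r + 2 \<le> 2 * h" using d[OF c] h by simp
      ultimately have "r + 2 \<le> h" by presburger
      then show "4 * k + 6 \<le> wt c" unfolding h by (simp add: r_def)
    next
      have "2 * r + 4 = 4 * k + 6" by (simp add: r_def)
      then show "\<exists>c\<in>C. wt c = 4 * k + 6" using W4[OF that] by (simp only:)
    qed simp
  qed
  \<comment> \<open>A doubly even code has the zero word in its generalized shadow, so half the
    length would be divisible by 4; modulo 4 it is that of 7, 9, 10 or 11.\<close>
  have se: "singly_even C" if \<alpha>: "\<alpha> \<in> {14, 18, 20, 22}"
  proof (rule ccontr)
    assume "\<not> singly_even C"
    then have "doubly_even C" using singly_or_doubly_even[OF C] by blast
    then have "0 \<in> gen_shadow C"
      using linear_code_0[OF self_dual_codeD(1)[OF C]] by (simp add: gen_shadow_doubly_even)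
    moreover have "CARD('n) = 2 * (12 * k + \<alpha> div 2)" using assms(2) \<alpha> by auto
    ultimately have "wt (0 :: bit ^ 'n) mod 4 = (12 * k + \<alpha> div 2) mod 4"
      by (intro gen_shadow_wt_mod_4[OF C])
    also have "\<dots> = (4 * (3 * k) + \<alpha> div 2) mod 4" by simp
    also have "\<dots> = (\<alpha> div 2) mod 4" by (rule mod_mult_self4)
    finally show False using \<alpha> by auto
  qed
  have s_ext: "s_extremal C \<and> min_weight C = (if e = 5 then 4 * k + 6 else 4 * k + 4)"
    if se: "singly_even C" and \<alpha>: "\<alpha> = 12 + 2 * e" and e: "1 \<le> e" "e \<le> 5"
      and \<beta>: "\<beta> \<ge> 6" "e \<ge> 2 \<Longrightarrow> \<beta> \<ge> 8" for e
  proof -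
    have n: "CARD('n) = 24 * k + (12 + 2 * e)" using assms(2) \<alpha> by simp
    have m: "CARD('n) mod 24 = 12 + 2 * e" "CARD('n) div 24 = k"
      unfolding n using e by simp_all
    have sw: "shadow_min_weight C = 4 * k + 2 + e" by (rule main(1)[OF se \<alpha> e \<beta>])
    show ?thesis
    \<comment> \<open>For \<open>e = 5\<close> the exceptional clause of \<open>s_extremal\<close>
      applies and its value is \<open>4 * k + 7\<close>; otherwise the general bound equals
      \<open>4 * k + 2 + e\<close>.\<close>
    proof (cases "e = 5")
      case True
      then show ?thesis
        using main(3)[OF se \<alpha> e \<beta> True] se n by (simp add: s_extremal_def m sw)
    next
      case False
      then have "e \<le> 4" using e by simp
      then show ?thesis
        using main(2)[OF se \<alpha> e \<beta> \<open>e \<le> 4\<close>] se n by (simp add: s_extremal_def m sw)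
    qed
  qed
  have c14: "s_extremal C \<and> min_weight C = 4 * k + 4" if "\<alpha> = 14" "\<beta> = 6"
    using s_ext[of 1] se that by simp
  have c16: "s_extremal C \<and> min_weight C = 4 * k + 4" if "\<alpha> = 16" "\<beta> = 8" "singly_even C"
    using s_ext[of 2] that by simp
  have c18: "s_extremal C \<and> min_weight C = 4 * k + 4" if "\<alpha> = 18" "\<beta> = 8"
    using s_ext[of 3] se that by simp
  have c20: "s_extremal C \<and> min_weight C = 4 * k + 4" if "\<alpha> = 20" "\<beta> = 8"
    using s_ext[of 4] se that by simp
  have c22: "s_extremal C \<and> min_weight C = 4 * k + 6" if "\<alpha> = 22" "\<beta> = 8"
    using s_ext[of 5] se that by simp
  have de: "extremal C" if "\<alpha> = 16" "\<beta> = 8" "doubly_even C"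
  proof -
    have d: "4 * k + 4 \<le> wt c" if "c \<in> C" "c \<noteq> 0" for c
      using dmin that \<open>\<beta> = 8\<close> by simp
    have "min_weight C = 4 * k + 4"
      using doubly_even_weight[OF that(3) _ d] d assms(2) that(1) by (intro min_weight_eqI) auto
    then show ?thesis
      using C assms(2) that(1) by (simp add: extremal_def)
  qed
  show ?thesis
    using c14 c16 c18 c20 c22 de by auto
qed

end
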